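(* Let $T>0$, $r>0$, $\theta\in(0,1]$, let $\eta:[-r,0]\to\mathbb R_+$ be $\theta$-Hölder continuous, let $b,\sigma:[0,T]\times\mathcal C_r\to\mathbb R$ satisfy the assumptions on $b$ and $\sigma$ listed in the context, with $\beta\in(0,1)$ the time-Hölder exponent of $\sigma$, let $0<\alpha<\frac12\wedge\theta\wedge\beta$, and let $g\in W^{1-\alpha,\infty}_{[0,T]}$. Then the equation $$x(t)=\eta(0)+\int_0^t b(s,x_s)\,ds+\int_0^t\sigma(s,x_s)\,dg_s+y(t),\quad t\in[0,T],\qquad x(t)=\eta(t),\quad t\in[-r,0],$$ with $$y(t)=\sup_{0\le s\le t}\big(z(s)\big)^-,\qquad z(t)=\eta(0)+\int_0^t b(s,x_s)\,ds+\int_0^t\sigma(s,x_s)\,dg_s,$$ possesses a solution $x\in C^{\theta\wedge\frac12}([-r,T])$.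
   Context: Notation: $a^-=\max(-a,0)$, $a\wedge b=\min(a,b)$. $\mathcal C_r=C([-r,0],\mathbb R)$ with the sup norm $\|\cdot\|_{\mathcal C_r}$. For $x:[-r,T]\to\mathbb R$ continuous and $t\in[0,T]$, $x_t\in\mathcal C_r$ is $x_t(s)=x(t+s)$, $s\in[-r,0]$. $C^\mu([a,b])$ is the space of $\mu$-Hölder continuous real functions on $[a,b]$. Assumptions on $b$: $b:[0,T]\times\mathcal C_r\to\mathbb R$ is measurable and there are constants with $|b(t,x)|\le L_b^2(1+\|x\|_{\mathcal C_r})$ and $|b(t,x)-b(t,y)|\le L_b^1\|x-y\|_{\mathcal C_r}$ for all $t\in[0,T]$, $x,y\in\mathcal C_r$. Assumptions on $\sigma$: $\sigma:[0,T]\times\mathcal C_r\to\mathbb R$ and there are constants and $\beta\in(0,1)$ with $|\sigma(t,x)|\le L_\sigma^1(1+\|x\|_{\mathcal C_r})$, $|\sigma(t,x)-\sigma(s,x)|\le L_\sigma^3|t-s|^\beta(1+\|x\|_{\mathcal C_r})$, $|\sigma(t,x)-\sigma(t,y)|\le L_\sigma^2\|x-y\|_{\mathcal C_r}$ for all $s,t\in[0,T]$, $x,y\in\mathcal C_r$. $W^{1-\alpha,\infty}_{[0,T]}$ is the space of measurable $g:[0,T]\to\mathbb R$ with $$\sup_{0\le u<v\le T}\Big(\frac{|g(v)-g(u)|}{(v-u)^{1-\alpha}}+\int_u^v\frac{|g(y)-g(u)|}{(y-u)^{2-\alpha}}dy\Big)<\infty .$$ Integral with respect to $g$ (generalized Lebesgue–Stieltjes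 integral in the sense of Zähle): $$\int_a^b f\,dg:=(-1)^\alpha\int_a^b D^\alpha_{a+}f(x)\,D^{1-\alpha}_{b-}g_{b-}(x)\,dx,\qquad g_{b-}(x)=g(x)-g(b-),$$ whenever $D^\alpha_{a+}f\in L^1[a,b]$ and $D^{1-\alpha}_{b-}g_{b-}\in L^\infty[a,b]$, and $\int_c^d f\,dg:=\int_a^b \mathbf 1_{(c,d)}f\,dg$ for $a\le c<d\le b$. The Weyl–Marchaud derivatives are, for $x\in(a,b)$, $$D_{a+}^{\alpha}f(x)=\frac{1}{\Gamma(1-\alpha)}\Big(\frac{f(x)}{(x-a)^{\alpha}}+\alpha\int_a^x\frac{f(x)-f(y)}{(x-y)^{\alpha+1}}dy\Big),\quad D_{b-}^{\alpha}f(x)=\frac{(-1)^\alpha}{\Gamma(1-\alpha)}\Big(\frac{f(x)}{(b-x)^{\alpha}}+\alpha\int_x^b\frac{f(x)-f(y)}{(y-x)^{\alpha+1}}dy\Big).$$ A solution is a continuous function on $[-r,T]$ for which all integrals are defined and the equation holds for all $t$. *)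

theory Defs
  imports "HOL-Analysis.Analysis"
begin

definition holder_on :: "real \<Rightarrow> real set \<Rightarrow> (real \<Rightarrow> real) \<Rightarrow> bool" where
  "holder_on \<mu> S f \<longleftrightarrow> (\<exists>C. \<forall>s\<in>S. \<forall>t\<in>S. \<bar>f s - f t\<bar> \<le> C * \<bar>s - t\<bar> powr \<mu>)"

(* C([-r,0]) with the sup norm is realised inside the bounded continuous functions on the whole
   line: a function on [-r,0] is identified with its extension that is constant to the left of -r
   and to the right of 0. The library norm of such a function is its sup norm over [-r,0]
   (norm_path_space), and every continuous function on [-r,0] arises exactly once
   (path_space_ex1). *)

definition path_space :: "real \<Rightarrow> (real \<Rightarrow>\<^sub>C real) set" where
  "path_space r = {\<phi>. (\<forall>s\<le>-r. apply_bcontfun \<phi> s = apply_bcontfun \<phi> (-r)) \<and>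
                      (\<forall>s\<ge>0. apply_bcontfun \<phi> s = apply_bcontfun \<phi> 0)}"

(* The segment x_t(s) = x(t+s), s in [-r,0]. It is meaningful for x continuous on [t-r,t]. *)

definition segment :: "real \<Rightarrow> (real \<Rightarrow> real) \<Rightarrow> real \<Rightarrow> (real \<Rightarrow>\<^sub>C real)" where
  "segment r x t = Bcontfun (\<lambda>s. x (t + max (-r) (min s 0)))"

lemma segment_bcontfun:
  fixes x :: "real \<Rightarrow> real"
  assumes "r > 0" "continuous_on {t-r..t} x"
  shows "(\<lambda>s. x (t + max (-r) (min s 0))) \<in> bcontfun"
proof -
  let ?c = "\<lambda>s::real. t + max (-r) (min s 0)"
  have sub: "range ?c \<subseteq> {t-r..t}" using assms(1) by auto
  have "continuous_on UNIV ?c" by (intro continuous_intros)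
  then have "continuous_on UNIV (\<lambda>s. x (?c s))"
    using continuous_on_compose2[OF assms(2)] sub by blast
  moreover have "bounded (x ` {t-r..t})"
    using assms(2) compact_continuous_image compact_imp_bounded by blast
  then have "bounded (range (\<lambda>s. x (?c s)))"
    by (rule bounded_subset) (use sub in auto)
  ultimately show ?thesis by (simp add: bcontfun_def)
qed

lemma apply_segment:
  assumes "r > 0" "continuous_on {t-r..t} x" "s \<in> {-r..0}"
  shows "apply_bcontfun (segment r x t) s = x (t + s)"
  using Bcontfun_inverse[OF segment_bcontfun[OF assms(1,2)]] assms(3)
  by (simp add: segment_def)

lemma segment_in_path_space:
  assumes "r > 0" "continuous_on {t-r..t} x"
  shows "segment r x t \<in> path_space r"
  using Bcontfun_inverse[OF segment_bcontfun[OF assms]] assms(1)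
  by (auto simp: segment_def path_space_def max_def min_def)

lemma path_space_clamp:
  assumes "r > 0" "\<phi> \<in> path_space r"
  shows "apply_bcontfun \<phi> s = apply_bcontfun \<phi> (max (-r) (min s 0))"
proof -
  consider "s \<le> -r" | "s \<ge> 0" | "-r < s" "s < 0" by linarith
  then show ?thesis
  proof cases
    case 1
    then have "max (-r) (min s 0) = -r" using assms(1) by simp
    then show ?thesis using 1 assms(2) unfolding path_space_def
      by (metis (mono_tags, lifting) mem_Collect_eq)
  next
    case 2
    then have "max (-r) (min s 0) = 0" using assms(1) by simp
    then show ?thesis using 2 assms(2) unfolding path_space_def
      by (metis (mono_tags, lifting) mem_Collect_eq)
  next
    case 3
    then show ?thesis by simp
  qed
qed

lemma norm_path_space:
  assumes "r > 0" "\<phi> \<in> path_space r"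
  shows "norm \<phi> = (SUP s\<in>{-r..0}. \<bar>apply_bcontfun \<phi> s\<bar>)"
proof -
  have bdd: "bdd_above ((\<lambda>s. \<bar>apply_bcontfun \<phi> s\<bar>) ` {-r..0})"
    by (rule bdd_aboveI[of _ "norm \<phi>"]) (use norm_bounded[of \<phi>] in auto)
  have "norm \<phi> \<le> (SUP s\<in>{-r..0}. \<bar>apply_bcontfun \<phi> s\<bar>)"
  proof (rule norm_bound)
    fix s
    have "max (-r) (min s 0) \<in> {-r..0}" using assms(1) by auto
    from cSUP_upper[OF this bdd]
    show "norm (apply_bcontfun \<phi> s) \<le> (SUP s\<in>{-r..0}. \<bar>apply_bcontfun \<phi> s\<bar>)"
      by (subst path_space_clamp[OF assms, of s]) simp
  qed
  moreover have "(SUP s\<in>{-r..0}. \<bar>apply_bcontfun \<phi> s\<bar>) \<le> norm \<phi>"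
    by (rule cSUP_least) (use assms(1) norm_bounded[of \<phi>] in auto)
  ultimately show ?thesis by simp
qed

lemma path_space_ex1:
  assumes "r > 0" "continuous_on {-r..0} f"
  shows "\<exists>!\<phi>. \<phi> \<in> path_space r \<and> (\<forall>s\<in>{-r..0}. apply_bcontfun \<phi> s = f s)"
proof -
  have seg: "segment r f 0 \<in> path_space r \<and>
      (\<forall>s\<in>{-r..0}. apply_bcontfun (segment r f 0) s = f s)"
    using segment_in_path_space[of r 0 f] apply_segment[of r 0 f] assms by simp
  have uniq: "\<phi> = segment r f 0"
    if \<phi>: "\<phi> \<in> path_space r \<and> (\<forall>s\<in>{-r..0}. apply_bcontfun \<phi> s = f s)" for \<phi>
  proof (rule bcontfun_eqI)
    fix s
    have "max (-r) (min s 0) \<in> {-r..0}" using assms(1) by auto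
    then show "apply_bcontfun \<phi> s = apply_bcontfun (segment r f 0) s"
      using path_space_clamp[OF assms(1), of \<phi> s] \<phi> seg
        path_space_clamp[OF assms(1), of "segment r f 0" s] by metis
  qed
  from seg uniq show ?thesis by (rule ex1I)
qed

definition drift_coeff :: "real \<Rightarrow> real \<Rightarrow> (real \<Rightarrow> (real \<Rightarrow>\<^sub>C real) \<Rightarrow> real) \<Rightarrow> bool" where
  "drift_coeff T r b \<longleftrightarrow>
     (\<lambda>(t, \<phi>). b t \<phi>) \<in> borel_measurable
        (restrict_space borel {0..T} \<Otimes>\<^sub>M restrict_space borel (path_space r)) \<and>
     (\<exists>L. \<forall>t\<in>{0..T}. \<forall>\<phi>\<in>path_space r. \<bar>b t \<phi>\<bar> \<le> L * (1 + norm \<phi>)) \<and>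
     (\<exists>L. \<forall>t\<in>{0..T}. \<forall>\<phi>\<in>path_space r. \<forall>\<psi>\<in>path_space r.
        \<bar>b t \<phi> - b t \<psi>\<bar> \<le> L * norm (\<phi> - \<psi>))"

definition diffusion_coeff ::
  "real \<Rightarrow> real \<Rightarrow> real \<Rightarrow> (real \<Rightarrow> (real \<Rightarrow>\<^sub>C real) \<Rightarrow> real) \<Rightarrow> bool" where
  "diffusion_coeff T r \<beta> \<sigma> \<longleftrightarrow>
     (\<exists>L. \<forall>t\<in>{0..T}. \<forall>\<phi>\<in>path_space r. \<bar>\<sigma> t \<phi>\<bar> \<le> L * (1 + norm \<phi>)) \<and>
     (\<exists>L. \<forall>t\<in>{0..T}. \<forall>s\<in>{0..T}. \<forall>\<phi>\<in>path_space r.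
        \<bar>\<sigma> t \<phi> - \<sigma> s \<phi>\<bar> \<le> L * \<bar>t - s\<bar> powr \<beta> * (1 + norm \<phi>)) \<and>
     (\<exists>L. \<forall>t\<in>{0..T}. \<forall>\<phi>\<in>path_space r. \<forall>\<psi>\<in>path_space r.
        \<bar>\<sigma> t \<phi> - \<sigma> t \<psi>\<bar> \<le> L * norm (\<phi> - \<psi>))"

(* Membership in W^{1-alpha,infinity} on [0,T]. *)

definition W_space :: "real \<Rightarrow> real \<Rightarrow> (real \<Rightarrow> real) \<Rightarrow> bool" where
  "W_space \<alpha> T g \<longleftrightarrow>
     g \<in> borel_measurable (restrict_space borel {0..T}) \<and>
     (SUP (u, v) \<in> {(u, v). 0 \<le> u \<and> u < v \<and> v \<le> T}.
        ennreal (\<bar>g v - g u\<bar> / (v - u) powr (1 - \<alpha>)) +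
        (\<integral>\<^sup>+y\<in>{u<..<v}. ennreal (\<bar>g y - g u\<bar> / (y - u) powr (2 - \<alpha>)) \<partial>lborel)) < \<infinity>"

definition weyl_left :: "real \<Rightarrow> real \<Rightarrow> (real \<Rightarrow> real) \<Rightarrow> real \<Rightarrow> real" where
  "weyl_left \<alpha> a f x =
     1 / Gamma (1 - \<alpha>) * (f x / (x - a) powr \<alpha> +
       \<alpha> * (LINT y:{a<..<x}|lborel. (f x - f y) / (x - y) powr (\<alpha> + 1)))"

(* The factor (-1)^alpha is the principal complex power exp(i pi alpha). *)

definition weyl_right :: "real \<Rightarrow> real \<Rightarrow> (real \<Rightarrow> real) \<Rightarrow> real \<Rightarrow> complex" where
  "weyl_right \<alpha> b f x =
     (-1) powr complex_of_real \<alpha> / complex_of_real (Gamma (1 - \<alpha>)) *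
     complex_of_real (f x / (b - x) powr \<alpha> +
       \<alpha> * (LINT y:{x<..<b}|lborel. (f x - f y) / (y - x) powr (\<alpha> + 1)))"

definition left_shift :: "(real \<Rightarrow> real) \<Rightarrow> real \<Rightarrow> real \<Rightarrow> real" where
  "left_shift g b x = g x - Lim (at_left b) g"

(* Conditions for the generalized Lebesgue-Stieltjes integral of f with respect to g over [a,b]
   to be defined. Since the Bochner integral of a non-integrable function is 0, the existence of
   the limit g(b-) and of the inner integrals (for almost every x) is required explicitly. *)

definition gls_integrable ::
  "real \<Rightarrow> real \<Rightarrow> real \<Rightarrow> (real \<Rightarrow> real) \<Rightarrow> (real \<Rightarrow> real) \<Rightarrow> bool" where
  "gls_integrable \<alpha> a b f g \<longleftrightarrow>
     (AE x in lborel. x \<in> {a<..<b} \<longrightarrow>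
        set_integrable lborel {a<..<x} (\<lambda>y. (f x - f y) / (x - y) powr (\<alpha> + 1))) \<and>
     set_integrable lborel {a<..<b} (weyl_left \<alpha> a f) \<and>
     (\<exists>l. (g \<longlongrightarrow> l) (at_left b)) \<and>
     (AE x in lborel. x \<in> {a<..<b} \<longrightarrow>
        set_integrable lborel {x<..<b}
          (\<lambda>y. (left_shift g b x - left_shift g b y) / (y - x) powr ((1 - \<alpha>) + 1))) \<and>
     set_borel_measurable lborel {a<..<b} (weyl_right (1 - \<alpha>) b (left_shift g b)) \<and>
     (\<exists>C. AE x in lborel. x \<in> {a<..<b} \<longrightarrow>
        norm (weyl_right (1 - \<alpha>) b (left_shift g b) x) \<le> C)"

definition gls_cintegral ::
  "real \<Rightarrow> real \<Rightarrow> real \<Rightarrow> (real \<Rightarrow> real) \<Rightarrow> (real \<Rightarrow> real) \<Rightarrow> complex" where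
  "gls_cintegral \<alpha> a b f g =
     (-1) powr complex_of_real \<alpha> *
     (CLINT x:{a<..<b}|lborel.
        complex_of_real (weyl_left \<alpha> a f x) * weyl_right (1 - \<alpha>) b (left_shift g b) x)"

(* The two complex factors multiply to -1, so the integral is real (gls_cintegral_real). *)

definition gls_integral ::
  "real \<Rightarrow> real \<Rightarrow> real \<Rightarrow> (real \<Rightarrow> real) \<Rightarrow> (real \<Rightarrow> real) \<Rightarrow> real" where
  "gls_integral \<alpha> a b f g = Re (gls_cintegral \<alpha> a b f g)"

lemma gls_cintegral_real:
  "gls_cintegral \<alpha> a b f g = complex_of_real (gls_integral \<alpha> a b f g)"
proof -
  have m1: "(-1) powr complex_of_real \<alpha> * (-1) powr complex_of_real (1 - \<alpha>) = -1"
  proof -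
    have "(-1) powr complex_of_real \<alpha> * (-1) powr complex_of_real (1 - \<alpha>) =
        (-1::complex) powr (complex_of_real \<alpha> + complex_of_real (1 - \<alpha>))"
      by (rule powr_add [symmetric])
    also have "complex_of_real \<alpha> + complex_of_real (1 - \<alpha>) = 1"
      by (simp only: of_real_diff of_real_1) algebra
    finally show ?thesis by simp
  qed
  define h where "h x = 1 / Gamma \<alpha> * (left_shift g b x / (b - x) powr (1 - \<alpha>) +
       (1 - \<alpha>) * (LINT y:{x<..<b}|lborel.
          (left_shift g b x - left_shift g b y) / (y - x) powr ((1 - \<alpha>) + 1)))" for x
  have w: "weyl_right (1 - \<alpha>) b (left_shift g b) x =
      (-1) powr complex_of_real (1 - \<alpha>) * complex_of_real (h x)" for x
    by (simp add: weyl_right_def h_def)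
  have "(CLINT x:{a<..<b}|lborel.
          complex_of_real (weyl_left \<alpha> a f x) * weyl_right (1 - \<alpha>) b (left_shift g b) x) =
        (CLINT x:{a<..<b}|lborel.
          (-1) powr complex_of_real (1 - \<alpha>) * complex_of_real (weyl_left \<alpha> a f x * h x))"
    unfolding w of_real_mult by (simp only: mult.left_commute)
  also have "\<dots> = (-1) powr complex_of_real (1 - \<alpha>) *
        (CLINT x:{a<..<b}|lborel. complex_of_real (weyl_left \<alpha> a f x * h x))"
    by (rule set_integral_mult_right)
  also have "(CLINT x:{a<..<b}|lborel. complex_of_real (weyl_left \<alpha> a f x * h x)) =
        complex_of_real (LINT x:{a<..<b}|lborel. weyl_left \<alpha> a f x * h x)"
    by (rule set_integral_complex_of_real)
  finally have "gls_cintegral \<alpha> a b f g =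
      complex_of_real (- (LINT x:{a<..<b}|lborel. weyl_left \<alpha> a f x * h x))"
    unfolding gls_cintegral_def by (simp only: mult.assoc [symmetric] m1) simp
  then show ?thesis unfolding gls_integral_def by (simp only: Re_complex_of_real)
qed

(* The integral over a subinterval [c,d] of the base interval [a,b], by restriction of the
   integrand to (c,d); for c = d it is 0. *)

definition gls_integrable_sub ::
  "real \<Rightarrow> real \<Rightarrow> real \<Rightarrow> real \<Rightarrow> real \<Rightarrow> (real \<Rightarrow> real) \<Rightarrow> (real \<Rightarrow> real) \<Rightarrow> bool" where
  "gls_integrable_sub \<alpha> a b c d f g \<longleftrightarrow>
     gls_integrable \<alpha> a b (\<lambda>s. indicator {c<..<d} s * f s) g"

definition gls_integral_sub ::
  "real \<Rightarrow> real \<Rightarrow> real \<Rightarrow> real \<Rightarrow> real \<Rightarrow> (real \<Rightarrow> real) \<Rightarrow> (real \<Rightarrow> real) \<Rightarrow> real" where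
  "gls_integral_sub \<alpha> a b c d f g = gls_integral \<alpha> a b (\<lambda>s. indicator {c<..<d} s * f s) g"

definition free_process where
  "free_process \<alpha> T r \<eta> b \<sigma> g x t =
     \<eta> 0 + (LINT s:{0..t}|lborel. b s (segment r x s)) +
     gls_integral_sub \<alpha> 0 T 0 t (\<lambda>s. \<sigma> s (segment r x s)) g"
  for \<alpha> T r :: real and \<eta> g x :: "real \<Rightarrow> real" and b \<sigma> :: "real \<Rightarrow> (real \<Rightarrow>\<^sub>C real) \<Rightarrow> real"
    and t :: real

definition regulator :: "(real \<Rightarrow> real) \<Rightarrow> real \<Rightarrow> real" where
  "regulator z t = (SUP s\<in>{0..t}. max (- z s) 0)"

(* The boundedness condition makes the conditionally complete supremum in regulator genuine. *)

definition reflected_solution where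
  "reflected_solution \<alpha> T r \<eta> b \<sigma> g x \<longleftrightarrow>
     continuous_on {-r..T} x \<and>
     (\<forall>t\<in>{0..T}. set_integrable lborel {0..t} (\<lambda>s. b s (segment r x s))) \<and>
     (\<forall>t\<in>{0<..T}. gls_integrable_sub \<alpha> 0 T 0 t (\<lambda>s. \<sigma> s (segment r x s)) g) \<and>
     bdd_above ((\<lambda>s. max (- free_process \<alpha> T r \<eta> b \<sigma> g x s) 0) ` {0..T}) \<and>
     (\<forall>t\<in>{0..T}. x t = free_process \<alpha> T r \<eta> b \<sigma> g x t +
                        regulator (free_process \<alpha> T r \<eta> b \<sigma> g x) t) \<and>
     (\<forall>t\<in>{-r..0}. x t = \<eta> t)"
  for \<alpha> T r :: real and \<eta> g x :: "real \<Rightarrow> real" and b \<sigma> :: "real \<Rightarrow> (real \<Rightarrow>\<^sub>C real) \<Rightarrow> real"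

end

theory Submission
  imports Defs "HOL-Complex_Analysis.Great_Picard"
begin

text \<open>The solution is the limit of a Tonelli scheme. If the coefficients are evaluated along the path
  delayed by a further \<open>\<delta> > 0\<close>, the equation can be solved explicitly on successive intervals of
  length \<open>\<delta>\<close>. With \<open>\<gamma> = min \<theta> (1/2)\<close>, the integral against \<open>g\<close> gains Hoelder exponent
  \<open>1 - \<alpha> > \<gamma>\<close>, and the Skorokhod regulator preserves bounds on increments; so there is a step
  \<open>\<epsilon>\<close>, depending only on the data because the coefficients grow linearly, such that sup norm and
  \<open>\<gamma>\<close>-Hoelder constant at most double on each interval of length \<open>\<epsilon>\<close>. These bounds are uniform in
  \<open>\<delta>\<close>; Arzela-Ascoli and dominated convergence in the fractional integral let \<open>\<delta>\<close> tend to 0.\<close>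

section \<open>Weyl derivatives of truncated functions\<close>

text \<open>Compactness replaces contraction because the Lipschitz condition on \<sigma> controls
  \<sigma>(s, x_s) - \<sigma>(s, y_s) pointwise but not its Hoelder constant, on which the integral
  against g depends. All integrals share the base interval [0,T], so an increment from s to t is the
  integral of an integrand cut off to (s,t). The cutoff creates jumps, and its left derivative does
  not vanish after t; yet its singularities at s and t are of order \<alpha> < 1, and its L1 norm is
  of order (t - s)^(1 - \<alpha>). The factor coming from g is one fixed bounded function on (0,T).
  This L1 bound is the source of the exponent 1 - \<alpha>. The doubling bounds are proved not as an
  estimate for solutions but as invariance of a class of paths under the solution map, so that every
  iterate of the delayed scheme inherits them.\<close>

lemma powr_kernel_left:
  fixes p q a :: real
  assumes "p \<le> q" "-1 < a"
  shows "has_bochner_integral lborel (\<lambda>x. indicator {p<..<q} x * (x - p) powr a)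
           ((q - p) powr (a + 1) / (a + 1))"
proof (cases "p = q")
  case True
  then show ?thesis by (simp add: has_bochner_integral_zero)
next
  case False
  then have pq: "p < q" using assms by simp
  let ?F = "\<lambda>x. (x - p) powr (a + 1) / (a + 1)"
  have lim0: "(?F \<longlongrightarrow> ?F p) (at_right p)"
    using assms by (auto intro!: tendsto_eq_intros simp: eventually_at_filter)
  have lim1: "(?F \<longlongrightarrow> ?F q) (at_left q)"
    using assms pq by (auto intro!: tendsto_eq_intros)
  have der: "DERIV ?F x :> (x - p) powr a" if "ereal p < ereal x" "ereal x < ereal q" for x
    using that assms
    by (auto intro!: derivative_eq_intros simp: powr_diff[of "x - p" "a + 1" 1, simplified] divide_simps)
  have cont: "isCont (\<lambda>x. (x - p) powr a) x" if "ereal p < ereal x" "ereal x < ereal q" for x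
    using that by (auto intro!: continuous_intros)
  have "set_integrable lborel (einterval p q) (\<lambda>x. (x - p) powr a)"
    "(LBINT x=ereal p..ereal q. (x - p) powr a) = ?F q - ?F p"
    by (rule interval_integral_FTC_nonneg[where F="?F", OF _ der cont];
        use pq lim0 lim1 in \<open>simp add: ereal_tendsto_simps1\<close>)+
  then show ?thesis
    using pq assms by (simp add: has_bochner_integral_iff set_integrable_def interval_lebesgue_integral_def
      set_lebesgue_integral_def einterval_eq_Icc)
qed

lemma powr_kernel_right:
  fixes p q a :: real
  assumes "p \<le> q" "-1 < a"
  shows "has_bochner_integral lborel (\<lambda>y. indicator {p<..<q} y * (q - y) powr a)
           ((q - p) powr (a + 1) / (a + 1))"
proof -
  \<comment> \<open>The reflection x -> p + q - x exchanges the endpoints and moves the singularity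
    from p to q.\<close>
  have "has_bochner_integral lborel (\<lambda>x. indicator {p<..<q} (p + q + (-1) * x) * ((p + q + (-1) * x) - p) powr a)
           (((q - p) powr (a + 1) / (a + 1)) /\<^sub>R \<bar>-1\<bar>)"
    by (rule lborel_has_bochner_integral_real_affine_iff[THEN iffD1]) (use powr_kernel_left[OF assms] in auto)
  moreover have "indicator {p<..<q} (p + q + (-1) * x) = (indicator {p<..<q} x :: real)" for x
    by (auto simp: indicator_def)
  ultimately show ?thesis by simp
qed

text \<open>The power -\<alpha> - 1 is not integrable at 0; the integral is finite only because x
  keeps a positive distance from the interval. This is the contribution of a jump of the integrand
  at q.\<close>

lemma powr_kernel_away:
  fixes p q x \<alpha> :: real
  assumes "p \<le> q" "q < x" "0 < \<alpha>"
  shows "has_bochner_integral lborel (\<lambda>y. indicator {p<..<q} y * (x - y) powr (- \<alpha> - 1))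
           (((x - q) powr - \<alpha> - (x - p) powr - \<alpha>) / \<alpha>)"
proof (cases "p = q")
  case True
  then show ?thesis by (simp add: has_bochner_integral_zero)
next
  case False
  then have pq: "p < q" using assms by simp
  let ?F = "\<lambda>y. (x - y) powr - \<alpha> / \<alpha>"
  have lim0: "(?F \<longlongrightarrow> ?F p) (at_right p)"
    using assms by (auto intro!: tendsto_eq_intros)
  have lim1: "(?F \<longlongrightarrow> ?F q) (at_left q)"
    using assms pq by (auto intro!: tendsto_eq_intros)
  have der: "DERIV ?F y :> (x - y) powr (- \<alpha> - 1)" if "ereal p < ereal y" "ereal y < ereal q" for y
    using that assms by (auto intro!: derivative_eq_intros)
  have cont: "isCont (\<lambda>y. (x - y) powr (- \<alpha> - 1)) y" if "ereal p < ereal y" "ereal y < ereal q" for y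
    using that assms by (auto intro!: continuous_intros)
  have "set_integrable lborel (einterval p q) (\<lambda>y. (x - y) powr (- \<alpha> - 1))"
    "(LBINT y=ereal p..ereal q. (x - y) powr (- \<alpha> - 1)) = ?F q - ?F p"
    by (rule interval_integral_FTC_nonneg[where F="?F", OF _ der cont];
        use pq lim0 lim1 in \<open>simp add: ereal_tendsto_simps1\<close>)+
  then show ?thesis
    using pq assms by (simp add: has_bochner_integral_iff set_integrable_def interval_lebesgue_integral_def
      set_lebesgue_integral_def einterval_eq_Icc diff_divide_distrib)
qed

text \<open>Majorant in y of the difference quotient at x of f cut off to (s,t), where M bounds f
  and H is its \<delta>-Hoelder constant. For x inside (s,t), points y before s see the jump and
  points after s the Hoelder increment; for x beyond t only y in (s,t) contributes.\<close>

definition bump_kernel :: "real \<Rightarrow> real \<Rightarrow> real \<Rightarrow> real \<Rightarrow> real \<Rightarrow> real \<Rightarrow> real \<Rightarrow> real \<Rightarrow> real" where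
  "bump_kernel \<alpha> \<delta> M H s t x y =
     (if x < s then 0
      else if x < t then M * (indicator {0<..<s} y * (x - y) powr (- \<alpha> - 1))
        + H * (indicator {s<..<x} y * (x - y) powr (\<delta> - \<alpha> - 1))
      else M * (indicator {s<..<t} y * (x - y) powr (- \<alpha> - 1)))"

text \<open>The weight is \<open>(x - s) powr - \<alpha>\<close> on \<open>{s<..<t}\<close> and \<open>(x - t) powr - \<alpha> - (x - s) powr - \<alpha>\<close> on
  \<open>{t<..<T}\<close>; written as a combination of three powers, its integral is explicit.\<close>

definition bump_weight :: "real \<Rightarrow> real \<Rightarrow> real \<Rightarrow> real \<Rightarrow> real \<Rightarrow> real" where
  "bump_weight \<alpha> T s t x = 2 * (indicator {s<..<t} x * (x - s) powr - \<alpha>)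
     + indicator {t<..<T} x * (x - t) powr - \<alpha> - indicator {s<..<T} x * (x - s) powr - \<alpha>"

text \<open>For x off s and t the jump terms stay away from their singularity, and \<alpha> <
  \<delta> makes the exponent \<delta> - \<alpha> - 1 of the Hoelder term exceed -1.\<close>

lemma integrable_bump_kernel:
  assumes "0 \<le> s" "s \<le> t" "0 < \<alpha>" "\<alpha> < \<delta>" "x \<noteq> s" "x \<noteq> t"
  shows "integrable lborel (bump_kernel \<alpha> \<delta> M H s t x)"
proof -
  consider "x < s" | "s < x" "x < t" | "x > t" using assms by linarith
  then show ?thesis
  proof cases
    case 1
    then show ?thesis by (simp add: bump_kernel_def[abs_def])
  next
    case 2
    then show ?thesis
      using powr_kernel_away[of 0 s x \<alpha>] powr_kernel_right[of s x "\<delta> - \<alpha> - 1"] assms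
      by (simp add: bump_kernel_def[abs_def] has_bochner_integral_iff)
  next
    case 3
    then show ?thesis
      using powr_kernel_away[of s t x \<alpha>] assms
      by (simp add: bump_kernel_def[abs_def] has_bochner_integral_iff)
  qed
qed

text \<open>The two tails contribute a multiple of (T - t)^(1 - \<alpha>) - (T - s)^(1 - \<alpha>),
  which is at most 0. What remains comes from (s,t) alone, so the bound shrinks with t - s although
  the weight lives on all of (s,T).\<close>

lemma bump_weight_integral:
  assumes "0 \<le> s" "s \<le> t" "t \<le> T" "0 < \<alpha>" "\<alpha> < 1"
  shows "integrable lborel (bump_weight \<alpha> T s t)"
    and "integral\<^sup>L lborel (bump_weight \<alpha> T s t) \<le> 2 / (1 - \<alpha>) * (t - s) powr (1 - \<alpha>)"
proof -
  have *: "has_bochner_integral lborel (bump_weight \<alpha> T s t)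
    (2 * ((t - s) powr (- \<alpha> + 1) / (- \<alpha> + 1)) + (T - t) powr (- \<alpha> + 1) / (- \<alpha> + 1)
      - (T - s) powr (- \<alpha> + 1) / (- \<alpha> + 1))"
    unfolding bump_weight_def[abs_def]
    by (intro has_bochner_integral_add has_bochner_integral_diff has_bochner_integral_mult_right
        powr_kernel_left) (use assms in auto)
  then show "integrable lborel (bump_weight \<alpha> T s t)"
    by (simp add: has_bochner_integral_iff)
  have "(T - t) powr (- \<alpha> + 1) \<le> (T - s) powr (- \<alpha> + 1)"
    using assms by (intro powr_mono2) auto
  then have "(T - t) powr (- \<alpha> + 1) / (- \<alpha> + 1) \<le> (T - s) powr (- \<alpha> + 1) / (- \<alpha> + 1)"
    using assms by (intro divide_right_mono) auto
  then show "integral\<^sup>L lborel (bump_weight \<alpha> T s t) \<le> 2 / (1 - \<alpha>) * (t - s) powr (1 - \<alpha>)"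
    using * by (simp add: has_bochner_integral_iff)
qed

lemma bump_kernel_bound:
  fixes f \<psi> :: "real \<Rightarrow> real"
  assumes s: "0 \<le> s" "s \<le> t" and f: "\<And>y. y \<in> {0..t} \<Longrightarrow> \<bar>f y\<bar> \<le> M"
    and h: "\<And>u v. u \<in> {0..t} \<Longrightarrow> v \<in> {0..t} \<Longrightarrow> \<bar>f u - f v\<bar> \<le> H * \<bar>u - v\<bar> powr \<delta>"
    and \<psi>: "\<And>y. 0 < y \<Longrightarrow> y \<noteq> s \<Longrightarrow> y \<noteq> t \<Longrightarrow> \<psi> y = indicator {s<..<t} y * f y"
    and x: "x \<noteq> s" "x \<noteq> t" and y: "0 < y" "y < x" "y \<noteq> s" "y \<noteq> t"
  shows "\<bar>(\<psi> x - \<psi> y) / (x - y) powr (\<alpha> + 1)\<bar> \<le> bump_kernel \<alpha> \<delta> M H s t x y"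
proof -
  \<comment> \<open>Quotients become negative powers, the form in which the kernel integrals are
    computed.\<close>
  have dv: "c / (x - y) powr (\<alpha> + 1) = c * (x - y) powr (- \<alpha> - 1)" for c
    using powr_minus_divide[of "x - y" "\<alpha> + 1"] by simp
  have M0: "0 \<le> M" using f[of t] s by force
  consider "x < s" | "s < x" "x < t" "y < s" | "s < x" "x < t" "s < y" | "x > t" "s < y" "y < t" 
    | "x > t" "y < s" | "x > t" "t < y"
    using x y by linarith
  then show ?thesis
  proof cases
    case 1
    then show ?thesis using y \<psi>[of x] \<psi>[of y] s by (simp add: bump_kernel_def)
  next
    case 2
    then have "\<psi> x = f x" "\<psi> y = 0" using \<psi>[of x] \<psi>[of y] s y by auto
    moreover have "\<bar>f x\<bar> \<le> M" using f[of x] 2 s by auto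
    ultimately show ?thesis using 2 y
      by (simp add: bump_kernel_def abs_mult dv mult_right_mono del: times_divide_eq_left abs_divide)
  next
    case 3
    then have "\<psi> x = f x" "\<psi> y = f y" using \<psi>[of x] \<psi>[of y] s y by auto
    moreover have "\<bar>f x - f y\<bar> \<le> H * (x - y) powr \<delta>" using h[of x y] 3 s y by auto
    then have "\<bar>f x - f y\<bar> * (x - y) powr (- \<alpha> - 1) \<le> H * (x - y) powr \<delta> * (x - y) powr (- \<alpha> - 1)"
      by (rule mult_right_mono) simp
    moreover have "(x - y) powr \<delta> * (x - y) powr (- \<alpha> - 1) = (x - y) powr (\<delta> - \<alpha> - 1)"
      using powr_add[of "x - y" \<delta> "- \<alpha> - 1"] by (simp add: algebra_simps)
    ultimately show ?thesis using 3 y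
      by (simp add: bump_kernel_def abs_mult dv mult.assoc del: times_divide_eq_left abs_divide)
  next
    case 4
    then have "\<psi> x = 0" "\<psi> y = f y" using \<psi>[of x] \<psi>[of y] s y by auto
    moreover have "\<bar>f y\<bar> \<le> M" using f[of y] 4 s by auto
    ultimately show ?thesis using 4 s y
      by (simp add: bump_kernel_def abs_mult dv mult_right_mono del: times_divide_eq_left abs_divide)
  next
    case 5
    then show ?thesis using y \<psi>[of x] \<psi>[of y] s M0 by (simp add: bump_kernel_def)
  next
    case 6
    then show ?thesis using y \<psi>[of x] \<psi>[of y] s M0 by (simp add: bump_kernel_def)
  qed
qed

lemma AE_lborel_neq: "AE y in lborel. y \<noteq> (s::real)"
  using AE_lborel_singleton by auto

text \<open>The values of \<open>\<psi>\<close> at \<open>s\<close> and \<open>t\<close> are left free so that the difference of the truncations of \<open>f\<close> to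
  \<open>{0<..<t}\<close> and \<open>{0<..<s}\<close>, which is \<open>f s\<close> at \<open>s\<close>, is covered.\<close>

lemma weyl_left_bump:
  fixes f \<psi> :: "real \<Rightarrow> real"
  assumes s: "0 \<le> s" "s \<le> t" "t \<le> T" and a: "0 < \<alpha>" "\<alpha> < 1" "\<alpha> < \<delta>" "\<delta> \<le> 1"
    and f: "\<And>y. y \<in> {0..t} \<Longrightarrow> \<bar>f y\<bar> \<le> M"
    and h: "\<And>u v. u \<in> {0..t} \<Longrightarrow> v \<in> {0..t} \<Longrightarrow> \<bar>f u - f v\<bar> \<le> H * \<bar>u - v\<bar> powr \<delta>"
    and H0: "0 \<le> H"
    and \<psi>: "\<And>y. 0 < y \<Longrightarrow> y \<noteq> s \<Longrightarrow> y \<noteq> t \<Longrightarrow> \<psi> y = indicator {s<..<t} y * f y"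
    and [measurable]: "\<psi> \<in> borel_measurable borel"
    and x: "0 < x" "x < T" "x \<noteq> s" "x \<noteq> t"
  shows "set_integrable lborel {0<..<x} (\<lambda>y. (\<psi> x - \<psi> y) / (x - y) powr (\<alpha> + 1))"
    and "\<bar>weyl_left \<alpha> 0 \<psi> x\<bar>
      \<le> 1 / Gamma (1 - \<alpha>) * ((M + \<alpha> * (1 + T) / (\<delta> - \<alpha>) * H) * bump_weight \<alpha> T s t x)"
proof -
  let ?B = "bump_kernel \<alpha> \<delta> M H s t x"
  let ?G = "\<lambda>y. (\<psi> x - \<psi> y) / (x - y) powr (\<alpha> + 1)"
  have M0: "0 \<le> M" using f[of t] s by force
  have intB: "integrable lborel ?B" using integrable_bump_kernel s a x by blast
  have B0: "?B y \<ge> 0" for y using M0 H0 by (auto simp: bump_kernel_def)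
  have bd: "AE y in lborel. norm (indicator {0<..<x} y * ?G y) \<le> ?B y"
    using AE_lborel_neq[of s] AE_lborel_neq[of t]
  proof eventually_elim
    case (elim y)
    show ?case
    proof (cases "y \<in> {0<..<x}")
      case True
      then show ?thesis using bump_kernel_bound[OF s(1,2) f h \<psi> x(3,4), of y \<alpha>] elim by simp
    next
      case False
      then show ?thesis using B0[of y] by simp
    qed
  qed
  have intG: "integrable lborel (\<lambda>y. indicator {0<..<x} y * ?G y)"
    by (rule Bochner_Integration.integrable_bound[OF intB]) (use bd B0 in auto)
  then show "set_integrable lborel {0<..<x} ?G" by (simp add: set_integrable_def)
  have "\<bar>LINT y:{0<..<x}|lborel. ?G y\<bar> \<le> (\<integral>y. norm (indicator {0<..<x} y * ?G y) \<partial>lborel)"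
    using integral_norm_bound[of lborel "\<lambda>y. indicator {0<..<x} y * ?G y"]
    by (simp add: set_lebesgue_integral_def)
  also have "\<dots> \<le> integral\<^sup>L lborel ?B"
    by (rule integral_mono_AE[OF integrable_norm[OF intG] intB bd])
  finally have LB: "\<bar>LINT y:{0<..<x}|lborel. ?G y\<bar> \<le> integral\<^sup>L lborel ?B" .
  let ?c = "\<alpha> * (1 + T) / (\<delta> - \<alpha>) * H"
  have c0: "0 \<le> ?c" using a s H0 by auto
  \<comment> \<open>For x in (s,t) the jump at s integrates to M ((x - s)^(-\<alpha>) -
    x^(-\<alpha>)), and its negative part cancels the bound M x^(-\<alpha>) of the boundary term.
    Only the singularity at s survives.\<close>
  have key: "\<bar>\<psi> x / x powr \<alpha>\<bar> + \<alpha> * integral\<^sup>L lborel ?B \<le> (M + ?c) * bump_weight \<alpha> T s t x"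
  proof -
    consider "x < s" | "s < x" "x < t" | "x > t" using x by linarith
    then show ?thesis
    proof cases
      case 1
      then have "\<psi> x = 0" using \<psi>[of x] x by auto
      then show ?thesis using 1 s x by (simp add: bump_kernel_def[abs_def] bump_weight_def)
    next
      case 2
      have w: "bump_weight \<alpha> T s t x = (x - s) powr - \<alpha>" using 2 s by (simp add: bump_weight_def)
      have "\<psi> x = f x" using \<psi>[of x] x 2 by auto
      then have "\<bar>\<psi> x\<bar> \<le> M" using f[of x] x 2 by auto
      then have b1: "\<bar>\<psi> x / x powr \<alpha>\<bar> \<le> M * x powr - \<alpha>"
        using x by (simp add: abs_mult powr_minus_divide divide_right_mono)
      have "integral\<^sup>L lborel ?B = M * (((x - s) powr - \<alpha> - x powr - \<alpha>) / \<alpha>)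
          + H * ((x - s) powr (\<delta> - \<alpha>) / (\<delta> - \<alpha>))"
        using powr_kernel_away[of 0 s x \<alpha>] powr_kernel_right[of s x "\<delta> - \<alpha> - 1"] 2 a s
        by (simp add: bump_kernel_def[abs_def] has_bochner_integral_iff)
      then have "\<alpha> * integral\<^sup>L lborel ?B = M * (x - s) powr - \<alpha> - M * x powr - \<alpha>
          + \<alpha> * (H * ((x - s) powr (\<delta> - \<alpha>) / (\<delta> - \<alpha>)))"
        using a by (simp add: distrib_left right_diff_distrib diff_divide_distrib)
      \<comment> \<open>The base 1 + T rather than T is at least 1, so the exponent \<delta> may be
        raised to 1.\<close>
      moreover have "(x - s) powr (\<delta> - \<alpha>) \<le> (1 + T) * (x - s) powr - \<alpha>"
      proof -
        have "(x - s) powr (\<delta> - \<alpha>) = (x - s) powr \<delta> * (x - s) powr - \<alpha>"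
          by (simp flip: powr_add)
        moreover have "(x - s) powr \<delta> \<le> (1 + T) powr \<delta>"
          using 2 a x s by (intro powr_mono2) auto
        moreover have "(1 + T) powr \<delta> \<le> (1 + T) powr 1"
          using s a by (intro powr_mono) auto
        ultimately show ?thesis using s by (simp add: mult_right_mono)
      qed
      then have "\<alpha> * (H * ((x - s) powr (\<delta> - \<alpha>) / (\<delta> - \<alpha>)))
          \<le> \<alpha> * (H * ((1 + T) * (x - s) powr - \<alpha> / (\<delta> - \<alpha>)))"
        using a H0 by (intro mult_left_mono divide_right_mono) auto
      moreover have "(M + ?c) * (x - s) powr - \<alpha> = M * (x - s) powr - \<alpha>
          + \<alpha> * (H * ((1 + T) * (x - s) powr - \<alpha> / (\<delta> - \<alpha>)))"
        by (simp add: distrib_right distrib_left)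
      ultimately show ?thesis unfolding w using b1 by linarith
    next
      case 3
      then have "\<psi> x = 0" using \<psi>[of x] x by auto
      moreover have "integral\<^sup>L lborel ?B = M * (((x - t) powr - \<alpha> - (x - s) powr - \<alpha>) / \<alpha>)"
        using powr_kernel_away[of s t x \<alpha>] 3 a s
        by (simp add: bump_kernel_def[abs_def] has_bochner_integral_iff)
      moreover have w: "bump_weight \<alpha> T s t x = (x - t) powr - \<alpha> - (x - s) powr - \<alpha>"
        using 3 s x by (simp add: bump_weight_def)
      moreover have "(x - s) powr - \<alpha> \<le> (x - t) powr - \<alpha>"
        using 3 s a by (intro powr_mono2') auto
      then have "0 \<le> ?c * ((x - t) powr - \<alpha> - (x - s) powr - \<alpha>)" using mult_nonneg_nonneg[OF c0] by (metis diff_ge_0_iff_ge)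
      ultimately show ?thesis using a by (simp only: distrib_right) simp
    qed
  qed
  have G0: "0 < Gamma (1 - \<alpha>)" using a by (intro Gamma_real_pos) auto
  have "\<bar>weyl_left \<alpha> 0 \<psi> x\<bar> = 1 / Gamma (1 - \<alpha>) *
     \<bar>\<psi> x / x powr \<alpha> + \<alpha> * (LINT y:{0<..<x}|lborel. ?G y)\<bar>"
    using G0 by (simp add: weyl_left_def abs_mult)
  also have "\<dots> \<le> 1 / Gamma (1 - \<alpha>) * (\<bar>\<psi> x / x powr \<alpha>\<bar> + \<alpha> * integral\<^sup>L lborel ?B)"
    using G0 a LB by (intro mult_left_mono order_trans[OF abs_triangle_ineq] add_mono) (auto simp: abs_mult)
  also have "\<dots> \<le> 1 / Gamma (1 - \<alpha>) * ((M + ?c) * bump_weight \<alpha> T s t x)"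
    using G0 key by (intro mult_left_mono) auto
  finally show "\<bar>weyl_left \<alpha> 0 \<psi> x\<bar> \<le> 1 / Gamma (1 - \<alpha>) * ((M + ?c) * bump_weight \<alpha> T s t x)" .
qed

lemma weyl_left_measurable:
  assumes [measurable]: "\<psi> \<in> borel_measurable borel"
  shows "weyl_left \<alpha> a \<psi> \<in> borel_measurable borel"
proof -
  \<comment> \<open>The domain of the inner integral depends on x, so its indicator must be
    measurable jointly in both variables.\<close>
  have [measurable]: "Measurable.pred (borel \<Otimes>\<^sub>M borel) (\<lambda>p::real\<times>real. snd p \<in> {a<..<fst p})"
    unfolding greaterThanLessThan_iff by measurable
  show ?thesis
    unfolding weyl_left_def[abs_def] set_lebesgue_integral_def
    by measurable
qed

section \<open>The integral of Hoelder functions\<close>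

definition holder_bounded :: "real \<Rightarrow> real \<Rightarrow> real \<Rightarrow> real set \<Rightarrow> (real \<Rightarrow> real) \<Rightarrow> bool" where
  "holder_bounded \<mu> M H S f \<longleftrightarrow> (\<forall>s\<in>S. \<bar>f s\<bar> \<le> M) \<and>
     (\<forall>s\<in>S. \<forall>t\<in>S. \<bar>f s - f t\<bar> \<le> H * \<bar>s - t\<bar> powr \<mu>)"

lemma holder_boundedD:
  assumes "holder_bounded \<mu> M H S f"
  shows "s \<in> S \<Longrightarrow> \<bar>f s\<bar> \<le> M"
    and "s \<in> S \<Longrightarrow> t \<in> S \<Longrightarrow> \<bar>f s - f t\<bar> \<le> H * \<bar>s - t\<bar> powr \<mu>"
  using assms by (auto simp: holder_bounded_def)

lemma holder_bounded_mono:
  assumes "holder_bounded \<mu> M H S f" "M \<le> M'" "H \<le> H'" "S' \<subseteq> S"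
  shows "holder_bounded \<mu> M' H' S' f"
  unfolding holder_bounded_def
proof (intro conjI ballI)
  fix s t assume s: "s \<in> S'" "t \<in> S'"
  show "\<bar>f s\<bar> \<le> M'" using holder_boundedD(1)[OF assms(1), of s] s assms by fastforce
  have "\<bar>f s - f t\<bar> \<le> H * \<bar>s - t\<bar> powr \<mu>"
    using holder_boundedD(2)[OF assms(1)] s assms by blast
  also have "\<dots> \<le> H' * \<bar>s - t\<bar> powr \<mu>" using assms by (intro mult_right_mono) auto
  finally show "\<bar>f s - f t\<bar> \<le> H' * \<bar>s - t\<bar> powr \<mu>" .
qed

text \<open>The target is a metric space because the lemma also serves for the segment map s -> x_s
  with values in the bounded continuous functions.\<close>

lemma holder_imp_continuous_on:
  fixes f :: "real \<Rightarrow> 'a::metric_space"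
  assumes "\<And>s t. s \<in> S \<Longrightarrow> t \<in> S \<Longrightarrow> dist (f s) (f t) \<le> H * \<bar>s - t\<bar> powr \<mu>" "0 < \<mu>"
  shows "continuous_on S f"
  unfolding continuous_on_def
proof
  fix x assume x: "x \<in> S"
  have "((\<lambda>y. H * \<bar>y - x\<bar> powr \<mu>) \<longlongrightarrow> H * \<bar>x - x\<bar> powr \<mu>) (at x within S)"
    using assms(2) by (intro tendsto_intros) (auto simp: eventually_at_filter)
  then have "((\<lambda>y. H * \<bar>y - x\<bar> powr \<mu>) \<longlongrightarrow> 0) (at x within S)" by simp
  moreover have "\<forall>\<^sub>F y in at x within S. norm (dist (f y) (f x)) \<le> H * \<bar>y - x\<bar> powr \<mu>"
    using assms(1) x by (auto simp: eventually_at_filter)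
  ultimately have "((\<lambda>y. dist (f y) (f x)) \<longlongrightarrow> 0) (at x within S)"
    by (rule Lim_null_comparison[rotated])
  then show "(f \<longlongrightarrow> f x) (at x within S)" by (subst tendsto_dist_iff)
qed

lemma holder_bounded_imp_continuous_on:
  "holder_bounded \<mu> M H S f \<Longrightarrow> 0 < \<mu> \<Longrightarrow> continuous_on S f"
  by (rule holder_imp_continuous_on[of _ _ H \<mu>]) (auto simp: dist_real_def holder_bounded_def)

section \<open>The right derivative of the integrator\<close>

definition dual_kernel :: "real \<Rightarrow> real \<Rightarrow> (real \<Rightarrow> real) \<Rightarrow> real \<Rightarrow> real" where
  "dual_kernel \<alpha> b g x = 1 / Gamma \<alpha> * (left_shift g b x / (b - x) powr (1 - \<alpha>) +
       (1 - \<alpha>) * (LINT y:{x<..<b}|lborel.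
          (left_shift g b x - left_shift g b y) / (y - x) powr ((1 - \<alpha>) + 1)))"

lemma weyl_right_dual_kernel:
  "weyl_right (1 - \<alpha>) b (left_shift g b) x =
     (-1) powr complex_of_real (1 - \<alpha>) * complex_of_real (dual_kernel \<alpha> b g x)"
  by (simp add: weyl_right_def dual_kernel_def)

text \<open>The factors (-1)^\<alpha> and (-1)^(1 - \<alpha>) multiply to -1. From here on the
  integral is a real Lebesgue integral against \<open>dual_kernel\<close>, the right derivative of g
  without its complex factor.\<close>

lemma gls_integral_dual_kernel:
  "gls_integral \<alpha> a b f g = - (LINT x:{a<..<b}|lborel. weyl_left \<alpha> a f x * dual_kernel \<alpha> b g x)"
proof -
  have m1: "(-1) powr complex_of_real \<alpha> * (-1) powr complex_of_real (1 - \<alpha>) = -1"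
    by (subst powr_add[symmetric]) (simp flip: of_real_add)
  have "(CLINT x:{a<..<b}|lborel.
          complex_of_real (weyl_left \<alpha> a f x) * weyl_right (1 - \<alpha>) b (left_shift g b) x) =
        (CLINT x:{a<..<b}|lborel. (-1) powr complex_of_real (1 - \<alpha>) *
          complex_of_real (weyl_left \<alpha> a f x * dual_kernel \<alpha> b g x))"
    unfolding weyl_right_dual_kernel of_real_mult by (simp only: mult.left_commute)
  also have "\<dots> = (-1) powr complex_of_real (1 - \<alpha>) *
        complex_of_real (LINT x:{a<..<b}|lborel. weyl_left \<alpha> a f x * dual_kernel \<alpha> b g x)"
    by (simp only: set_integral_mult_right set_integral_complex_of_real)
  finally show ?thesis
    unfolding gls_integral_def gls_cintegral_def by (simp only: mult.assoc[symmetric] m1) simp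
qed

lemma W_space_bounds:
  assumes "W_space \<alpha> T g"
  obtains C where "0 \<le> C"
    and "\<And>u v. 0 \<le> u \<Longrightarrow> u < v \<Longrightarrow> v \<le> T \<Longrightarrow> \<bar>g v - g u\<bar> \<le> C * (v - u) powr (1 - \<alpha>)"
    and "\<And>u v. 0 \<le> u \<Longrightarrow> u < v \<Longrightarrow> v \<le> T \<Longrightarrow>
      (\<integral>\<^sup>+y\<in>{u<..<v}. ennreal (\<bar>g y - g u\<bar> / (y - u) powr (2 - \<alpha>)) \<partial>lborel) \<le> ennreal C"
proof -
  let ?F = "\<lambda>(u, v). ennreal (\<bar>g v - g u\<bar> / (v - u) powr (1 - \<alpha>)) +
        (\<integral>\<^sup>+y\<in>{u<..<v}. ennreal (\<bar>g y - g u\<bar> / (y - u) powr (2 - \<alpha>)) \<partial>lborel)"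
  define S where "S = (SUP p \<in> {(u, v). 0 \<le> u \<and> u < v \<and> v \<le> T}. ?F p)"
  have S: "S < \<infinity>" using assms by (simp add: W_space_def S_def)
  have up: "?F (u, v) \<le> ennreal (enn2real S)" if "0 \<le> u" "u < v" "v \<le> T" for u v
  proof -
    have "?F (u, v) \<le> S" unfolding S_def by (rule SUP_upper) (use that in auto)
    then show ?thesis using S by (simp add: less_top)
  qed
  show thesis
  proof
    fix u v assume uv: "0 \<le> u" "u < v" "v \<le> T"
    have "ennreal (\<bar>g v - g u\<bar> / (v - u) powr (1 - \<alpha>)) \<le> ennreal (enn2real S)"
      using up[OF uv] unfolding prod.case by (rule order_trans[rotated]) (intro add_increasing2, auto)
    then have "\<bar>g v - g u\<bar> / (v - u) powr (1 - \<alpha>) \<le> enn2real S" by (simp add: ennreal_le_iff)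
    then show "\<bar>g v - g u\<bar> \<le> enn2real S * (v - u) powr (1 - \<alpha>)"
      using uv by (simp add: divide_le_eq)
    show "(\<integral>\<^sup>+y\<in>{u<..<v}. ennreal (\<bar>g y - g u\<bar> / (y - u) powr (2 - \<alpha>)) \<partial>lborel) \<le> ennreal (enn2real S)"
      using up[OF uv] unfolding prod.case by (rule order_trans[rotated]) (intro add_increasing, auto)
  qed simp
qed

text \<open>The two summands of the right derivative at x are exactly the two quantities in the norm
  of g for u = x and v = T: the Hoelder quotient bounds the boundary term, the integral condition
  bounds the inner integral.\<close>

lemma dual_kernel_bounded:
  assumes W: "W_space \<alpha> T g" and T: "0 < T" and a: "0 < \<alpha>" "\<alpha> < 1"
  shows "(g \<longlongrightarrow> g T) (at_left T)" (is ?lim)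
    and "\<And>x. x \<in> {0<..<T} \<Longrightarrow> set_integrable lborel {x<..<T}
          (\<lambda>y. (left_shift g T x - left_shift g T y) / (y - x) powr ((1 - \<alpha>) + 1))"
    and "(\<lambda>x. indicator {0<..<T} x * dual_kernel \<alpha> T g x) \<in> borel_measurable borel" (is ?meas)
    and "\<exists>C\<ge>0. \<forall>x\<in>{0<..<T}. \<bar>dual_kernel \<alpha> T g x\<bar> \<le> C" (is ?bd)
proof -
  obtain C where C: "0 \<le> C"
    and hol: "\<And>u v. 0 \<le> u \<Longrightarrow> u < v \<Longrightarrow> v \<le> T \<Longrightarrow> \<bar>g v - g u\<bar> \<le> C * (v - u) powr (1 - \<alpha>)"
    and nn: "\<And>u v. 0 \<le> u \<Longrightarrow> u < v \<Longrightarrow> v \<le> T \<Longrightarrow>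
      (\<integral>\<^sup>+y\<in>{u<..<v}. ennreal (\<bar>g y - g u\<bar> / (y - u) powr (2 - \<alpha>)) \<partial>lborel) \<le> ennreal C"
    using W_space_bounds[OF W] by blast
  show lim: ?lim
  proof -
    have "((\<lambda>x. C * (T - x) powr (1 - \<alpha>)) \<longlongrightarrow> C * (T - T) powr (1 - \<alpha>)) (at_left T)"
      using a by (intro tendsto_intros) (auto simp: eventually_at_filter)
    then have "((\<lambda>x. C * (T - x) powr (1 - \<alpha>)) \<longlongrightarrow> 0) (at_left T)" by simp
    moreover have "\<forall>\<^sub>F x in at_left T. norm (g x - g T) \<le> C * (T - x) powr (1 - \<alpha>)"
      using eventually_at_left_real[OF T] by eventually_elim (use hol[of _ T] in \<open>auto simp: abs_minus_commute\<close>)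
    ultimately have "((\<lambda>x. g x - g T) \<longlongrightarrow> 0) (at_left T)" by (rule Lim_null_comparison[rotated])
    then show ?thesis by (simp add: LIM_zero_iff)
  qed
  have Lim: "Lim (at_left T) g = g T" using lim by (intro tendsto_Lim) auto
  have ls: "left_shift g T x = g x - g T" for x by (simp add: left_shift_def Lim)
  \<comment> \<open>g is measurable on [0,T] only. Its extension by 0 agrees with it wherever the
    kernel looks and is measurable on the line, which gives measurability of the inner integral in
    x.\<close>
  define G where "G y = indicator {0..T} y * g y" for y
  have [measurable]: "G \<in> borel_measurable borel"
    using W by (simp add: W_space_def G_def[abs_def] borel_measurable_restrict_space_iff)
  define k where "k x y = indicator {x<..<T} y * ((G x - G y) / (y - x) powr (2 - \<alpha>))" for x y
  have kx: "indicator {x<..<T} y * ((left_shift g T x - left_shift g T y) / (y - x) powr ((1 - \<alpha>) + 1)) = k x y"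
    if "x \<in> {0<..<T}" for x y
    using that by (auto simp: k_def G_def ls indicator_def)
  have nk: "(\<integral>\<^sup>+y. norm (k x y) \<partial>lborel) \<le> ennreal C" if x: "x \<in> {0<..<T}" for x
  proof -
    have "(\<integral>\<^sup>+y. norm (k x y) \<partial>lborel) =
        (\<integral>\<^sup>+y\<in>{x<..<T}. ennreal (\<bar>g y - g x\<bar> / (y - x) powr (2 - \<alpha>)) \<partial>lborel)"
      using x by (intro nn_integral_cong) (auto simp: k_def G_def indicator_def abs_minus_commute abs_mult)
    also have "\<dots> \<le> ennreal C" using nn[of x T] x by auto
    finally show ?thesis .
  qed
  have mk[measurable]: "k x \<in> borel_measurable lborel" for x
    unfolding k_def[abs_def] by measurable
  have ik: "integrable lborel (k x)" if x: "x \<in> {0<..<T}" for x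
    by (rule integrableI_bounded[OF mk]) (use nk[OF x] in \<open>auto intro: le_less_trans\<close>)
  show "set_integrable lborel {x<..<T}
          (\<lambda>y. (left_shift g T x - left_shift g T y) / (y - x) powr ((1 - \<alpha>) + 1))"
    if "x \<in> {0<..<T}" for x
    using ik[OF that] kx[OF that] by (simp add: set_integrable_def)
  have dk: "dual_kernel \<alpha> T g x = 1 / Gamma \<alpha> * ((G x - g T) / (T - x) powr (1 - \<alpha>)
      + (1 - \<alpha>) * (\<integral>y. k x y \<partial>lborel))" if x: "x \<in> {0<..<T}" for x
    using kx[OF x] x by (simp add: dual_kernel_def set_lebesgue_integral_def G_def ls)
  have [measurable]: "Measurable.pred (borel \<Otimes>\<^sub>M borel) (\<lambda>p::real\<times>real. snd p \<in> {fst p<..<T})"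
    unfolding greaterThanLessThan_iff by measurable
  have m2: "(\<lambda>x. \<integral>y. k x y \<partial>lborel) \<in> borel_measurable borel"
    unfolding k_def[abs_def] by measurable
  have "(\<lambda>x. indicator {0<..<T} x * (1 / Gamma \<alpha> * ((G x - g T) / (T - x) powr (1 - \<alpha>)
      + (1 - \<alpha>) * (\<integral>y. k x y \<partial>lborel)))) \<in> borel_measurable borel"
    using m2 by measurable
  also have "(\<lambda>x. indicator {0<..<T} x * (1 / Gamma \<alpha> * ((G x - g T) / (T - x) powr (1 - \<alpha>)
      + (1 - \<alpha>) * (\<integral>y. k x y \<partial>lborel)))) = (\<lambda>x. indicator {0<..<T} x * dual_kernel \<alpha> T g x)"
    using dk by (auto simp: indicator_def)
  finally show ?meas .
  have G0: "0 < Gamma \<alpha>" using a by (intro Gamma_real_pos) auto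
  show ?bd
  proof (intro exI[of _ "1 / Gamma \<alpha> * (C + (1 - \<alpha>) * C)"] conjI ballI)
    show "0 \<le> 1 / Gamma \<alpha> * (C + (1 - \<alpha>) * C)" using G0 C a by auto
    fix x assume x: "x \<in> {0<..<T}"
    have "ennreal (norm (\<integral>y. k x y \<partial>lborel)) \<le> ennreal C"
      using integral_norm_bound_ennreal[OF ik[OF x]] nk[OF x] by (rule order_trans)
    then have b1: "\<bar>\<integral>y. k x y \<partial>lborel\<bar> \<le> C" using C by (simp add: ennreal_le_iff)
    have "\<bar>G x - g T\<bar> \<le> C * (T - x) powr (1 - \<alpha>)"
      using hol[of x T] x by (auto simp: G_def abs_minus_commute)
    then have b2: "\<bar>(G x - g T) / (T - x) powr (1 - \<alpha>)\<bar> \<le> C"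
      using x by (simp add: divide_le_eq)
    have "\<bar>dual_kernel \<alpha> T g x\<bar> = 1 / Gamma \<alpha> * \<bar>(G x - g T) / (T - x) powr (1 - \<alpha>)
      + (1 - \<alpha>) * (\<integral>y. k x y \<partial>lborel)\<bar>"
      unfolding dk[OF x] using G0 by (simp add: abs_mult)
    also have "\<dots> \<le> 1 / Gamma \<alpha> * (C + (1 - \<alpha>) * C)"
      using G0 b1 b2 a by (intro mult_left_mono order_trans[OF abs_triangle_ineq] add_mono)
        (auto simp: abs_mult mult_left_mono)
    finally show "\<bar>dual_kernel \<alpha> T g x\<bar> \<le> 1 / Gamma \<alpha> * (C + (1 - \<alpha>) * C)" .
  qed
qed

section \<open>Existence, increments and limits of the integral\<close>

lemma cutoff_measurable:
  assumes "holder_bounded \<delta> M H {0..t} f" "0 < \<delta>"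
  shows "(\<lambda>s. indicator {0<..<t} s * f s) \<in> borel_measurable borel"
proof -
  have "continuous_on {0<..<t} f"
    by (rule continuous_on_subset[OF holder_bounded_imp_continuous_on[OF assms]]) auto
  then show ?thesis
    using borel_measurable_continuous_on_indicator[of "{0<..<t}" f] by simp
qed

text \<open>With s = 0 this provides the integrability demanded of the integrand cut off to (0,t);
  with general s the L1 bound controls the increment of the integral from s to t.\<close>

lemma weyl_left_integrable:
  fixes f \<psi> :: "real \<Rightarrow> real"
  assumes s: "0 \<le> s" "s \<le> t" "t \<le> T" and a: "0 < \<alpha>" "\<alpha> < 1" "\<alpha> < \<delta>" "\<delta> \<le> 1"
    and f: "holder_bounded \<delta> M H {0..t} f" and H: "0 \<le> H"
    and \<psi>: "\<And>y. 0 < y \<Longrightarrow> y \<noteq> s \<Longrightarrow> y \<noteq> t \<Longrightarrow> \<psi> y = indicator {s<..<t} y * f y"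
    and m[measurable]: "\<psi> \<in> borel_measurable borel"
  shows "set_integrable lborel {0<..<T} (weyl_left \<alpha> 0 \<psi>)"
    and "(\<integral>x. \<bar>indicator {0<..<T} x * weyl_left \<alpha> 0 \<psi> x\<bar> \<partial>lborel) \<le>
      2 / (Gamma (1 - \<alpha>) * (1 - \<alpha>)) * (M + \<alpha> * (1 + T) / (\<delta> - \<alpha>) * H) * (t - s) powr (1 - \<alpha>)"
proof -
  note weyl_left_measurable[OF m, measurable]
  let ?w = "\<lambda>x. 1 / Gamma (1 - \<alpha>) * ((M + \<alpha> * (1 + T) / (\<delta> - \<alpha>) * H) * bump_weight \<alpha> T s t x)"
  have M0: "0 \<le> M" using holder_boundedD(1)[OF f, of t] s by force
  have G0: "0 < Gamma (1 - \<alpha>)" using a by (intro Gamma_real_pos) auto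
  have c0: "0 \<le> M + \<alpha> * (1 + T) / (\<delta> - \<alpha>) * H" using M0 a s H by auto
  have iw: "integrable lborel ?w" using bump_weight_integral(1)[of s t T \<alpha>] s a by simp
  have bd: "AE x in lborel. \<bar>indicator {0<..<T} x * weyl_left \<alpha> 0 \<psi> x\<bar> \<le> ?w x"
    using AE_lborel_neq[of s] AE_lborel_neq[of t] AE_lborel_neq[of 0] AE_lborel_neq[of T]
  proof eventually_elim
    case (elim x)
    show ?case
    proof (cases "x \<in> {0<..<T}")
      case True
      have "\<bar>weyl_left \<alpha> 0 \<psi> x\<bar> \<le> ?w x"
        by (rule weyl_left_bump[OF s a _ _ H \<psi> m])
           (use True elim holder_boundedD[OF f] in auto)
      then show ?thesis using True by simp
    next
      case False
      then have "bump_weight \<alpha> T s t x = 0"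
        using elim s by (auto simp: bump_weight_def indicator_def)
      then show ?thesis using False by auto
    qed
  qed
  then show i: "set_integrable lborel {0<..<T} (weyl_left \<alpha> 0 \<psi>)"
    unfolding set_integrable_def
  proof (intro Bochner_Integration.integrable_bound[OF iw])
    show "AE x in lborel. norm (indicator {0<..<T} x *\<^sub>R weyl_left \<alpha> 0 \<psi> x) \<le> norm (?w x)"
      using bd by eventually_elim (metis abs_ge_self order_trans real_norm_def real_scaleR_def)
  qed measurable
  have "(\<integral>x. \<bar>indicator {0<..<T} x * weyl_left \<alpha> 0 \<psi> x\<bar> \<partial>lborel) \<le> integral\<^sup>L lborel ?w"
    by (rule integral_mono_AE[OF _ iw bd]) (use i in \<open>auto simp: set_integrable_def\<close>)
  also have "\<dots> = 1 / Gamma (1 - \<alpha>) * ((M + \<alpha> * (1 + T) / (\<delta> - \<alpha>) * H) *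
      integral\<^sup>L lborel (bump_weight \<alpha> T s t))"
    by simp
  also have "\<dots> \<le> 1 / Gamma (1 - \<alpha>) * ((M + \<alpha> * (1 + T) / (\<delta> - \<alpha>) * H) *
      (2 / (1 - \<alpha>) * (t - s) powr (1 - \<alpha>)))"
    using bump_weight_integral(2)[of s t T \<alpha>] s a G0 c0 by (intro mult_left_mono) auto
  also have "\<dots> = 2 / (Gamma (1 - \<alpha>) * (1 - \<alpha>)) * (M + \<alpha> * (1 + T) / (\<delta> - \<alpha>) * H) * (t - s) powr (1 - \<alpha>)"
    by simp
  finally show "(\<integral>x. \<bar>indicator {0<..<T} x * weyl_left \<alpha> 0 \<psi> x\<bar> \<partial>lborel) \<le> \<dots>" .
qed

lemma gls_integrable_sub_holder:
  assumes W: "W_space \<alpha> T g" and T: "0 < T" and t: "0 < t" "t \<le> T"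
    and a: "0 < \<alpha>" "\<alpha> < 1" "\<alpha> < \<delta>" "\<delta> \<le> 1"
    and f: "holder_bounded \<delta> M H {0..t} f" and H: "0 \<le> H"
  shows "gls_integrable_sub \<alpha> 0 T 0 t f g"
  unfolding gls_integrable_sub_def gls_integrable_def
proof (intro conjI)
  let ?\<phi> = "\<lambda>s. indicator {0<..<t} s * f s"
  note D = dual_kernel_bounded[OF W T a(1,2)]
  have m: "?\<phi> \<in> borel_measurable borel" using cutoff_measurable[OF f] a by simp
  show "AE x in lborel. x \<in> {0<..<T} \<longrightarrow>
        set_integrable lborel {0<..<x} (\<lambda>y. (?\<phi> x - ?\<phi> y) / (x - y) powr (\<alpha> + 1))"
    using AE_lborel_neq[of t]
  proof eventually_elim
    case (elim x)
    show ?case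
    proof
      assume "x \<in> {0<..<T}"
      then show "set_integrable lborel {0<..<x} (\<lambda>y. (?\<phi> x - ?\<phi> y) / (x - y) powr (\<alpha> + 1))"
        by (intro weyl_left_bump(1)[of 0 t T \<alpha> \<delta> f M H])
          (use t a elim m holder_boundedD[OF f] H in auto)
    qed
  qed
  show "set_integrable lborel {0<..<T} (weyl_left \<alpha> 0 ?\<phi>)"
    by (rule weyl_left_integrable(1)[where s=0, OF _ _ _ a f H _ m]) (use t in auto)
  show "\<exists>l. (g \<longlongrightarrow> l) (at_left T)" using D(1) by blast
  show "AE x in lborel. x \<in> {0<..<T} \<longrightarrow> set_integrable lborel {x<..<T}
      (\<lambda>y. (left_shift g T x - left_shift g T y) / (y - x) powr ((1 - \<alpha>) + 1))"
    using D(2) by auto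
  \<comment> \<open>The complex factor is a constant, so measurability reduces to that of the real
    kernel.\<close>
  define c where "c = (-1) powr complex_of_real (1 - \<alpha>)"
  have wc: "indicator {0<..<T} x *\<^sub>R weyl_right (1 - \<alpha>) T (left_shift g T) x =
      c * complex_of_real (indicator {0<..<T} x * dual_kernel \<alpha> T g x)" for x
    by (simp only: weyl_right_dual_kernel scaleR_conv_of_real of_real_mult mult.left_commute c_def)
  have "(\<lambda>x. complex_of_real (indicator {0<..<T} x * dual_kernel \<alpha> T g x)) \<in> borel_measurable borel"
    by (rule measurable_compose[OF D(3) borel_measurable_of_real])
  then have "(\<lambda>x. c * complex_of_real (indicator {0<..<T} x * dual_kernel \<alpha> T g x)) \<in> borel_measurable borel"
    by (rule borel_measurable_times[OF borel_measurable_const])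
  then show "set_borel_measurable lborel {0<..<T} (weyl_right (1 - \<alpha>) T (left_shift g T))"
    unfolding set_borel_measurable_def wc by (simp only: measurable_lborel2)
  obtain C where "\<forall>x\<in>{0<..<T}. \<bar>dual_kernel \<alpha> T g x\<bar> \<le> C" using D(4) by blast
  then show "\<exists>C. AE x in lborel. x \<in> {0<..<T} \<longrightarrow> norm (weyl_right (1 - \<alpha>) T (left_shift g T) x) \<le> C"
    by (intro exI[of _ "norm ((-1) powr complex_of_real (1 - \<alpha>)) * C"])
      (auto simp: weyl_right_dual_kernel norm_mult mult_left_mono)
qed

lemma gls_integral_sub_cong:
  assumes "\<And>s. s \<in> {0<..<t} \<Longrightarrow> f s = f' s"
  shows "gls_integral_sub \<alpha> a b 0 t f g = gls_integral_sub \<alpha> a b 0 t f' g"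
proof -
  have "(\<lambda>s. indicator {0<..<t} s * f s) = (\<lambda>s. indicator {0<..<t} s * f' s)"
    using assms by (auto simp: indicator_def)
  then show ?thesis by (simp add: gls_integral_sub_def)
qed

text \<open>Both inner integrals must converge: a divergent one would have the default value 0 and
  linearity could fail.\<close>

lemma weyl_left_diff:
  assumes "set_integrable lborel {0<..<x} (\<lambda>y. (f x - f y) / (x - y) powr (\<alpha> + 1))"
    and "set_integrable lborel {0<..<x} (\<lambda>y. (h x - h y) / (x - y) powr (\<alpha> + 1))"
  shows "weyl_left \<alpha> 0 (\<lambda>y. f y - h y) x = weyl_left \<alpha> 0 f x - weyl_left \<alpha> 0 h x"
proof -
  have eq: "((f x - h x) - (f y - h y)) / p = (f x - f y) / p - (h x - h y) / p" for y p
    by (simp add: divide_inverse algebra_simps)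
  have "(LINT y:{0<..<x}|lborel. ((f x - h x) - (f y - h y)) / (x - y) powr (\<alpha> + 1)) =
    (LINT y:{0<..<x}|lborel. (f x - f y) / (x - y) powr (\<alpha> + 1) - (h x - h y) / (x - y) powr (\<alpha> + 1))"
    by (simp add: eq)
  also have "\<dots> = (LINT y:{0<..<x}|lborel. (f x - f y) / (x - y) powr (\<alpha> + 1))
      - (LINT y:{0<..<x}|lborel. (h x - h y) / (x - y) powr (\<alpha> + 1))"
    by (rule set_integral_diff(2)[OF assms])
  finally show ?thesis
    unfolding weyl_left_def by (simp only: eq) (simp add: divide_inverse algebra_simps)
qed

text \<open>Both integrals use the same base interval and hence the same bounded kernel, so their
  difference is the integral of the cutoff to (s,t): an L1 bound times an L-infinity bound. The
  constant is chosen before f, M, H, s and t.\<close>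

lemma gls_integral_sub_increment:
  assumes W: "W_space \<alpha> T g" and T: "0 < T" and a: "0 < \<alpha>" "\<alpha> < 1" "\<alpha> < \<delta>" "\<delta> \<le> 1"
  obtains C where "0 \<le> C"
    and "\<And>f M H s t. holder_bounded \<delta> M H {0..t} f \<Longrightarrow> 0 \<le> H \<Longrightarrow> 0 \<le> s \<Longrightarrow> s \<le> t \<Longrightarrow> t \<le> T \<Longrightarrow>
      \<bar>gls_integral_sub \<alpha> 0 T 0 t f g - gls_integral_sub \<alpha> 0 T 0 s f g\<bar> \<le> C * (M + H) * (t - s) powr (1 - \<alpha>)"
proof -
  let ?d = "\<lambda>x. indicator {0<..<T} x * dual_kernel \<alpha> T g x"
  note D = dual_kernel_bounded[OF W T a(1,2)]
  note [measurable] = D(3)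
  obtain L where L: "0 \<le> L" "\<And>x. x \<in> {0<..<T} \<Longrightarrow> \<bar>dual_kernel \<alpha> T g x\<bar> \<le> L" using D(4) by blast
  have L': "\<bar>?d x\<bar> \<le> L" for x using L by (auto simp: indicator_def)
  define c where "c = \<alpha> * (1 + T) / (\<delta> - \<alpha>)"
  define K where "K = L * (2 / (Gamma (1 - \<alpha>) * (1 - \<alpha>)))"
  have G0: "0 < Gamma (1 - \<alpha>)" using a by (intro Gamma_real_pos) auto
  have c0: "0 \<le> c" using a T by (simp add: c_def)
  have K0: "0 \<le> K" using L G0 a by (simp add: K_def)
  show thesis
  proof
    show "0 \<le> K * (1 + c)" using K0 c0 by simp
    fix f M H s t
    assume f: "holder_bounded \<delta> M H {0..t} f" and H: "0 \<le> H" and s: "0 \<le> s" "s \<le> t" "t \<le> T"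
    have M0: "0 \<le> M" using holder_boundedD(1)[OF f, of t] s by force
    have fs: "holder_bounded \<delta> M H {0..s} f" by (rule holder_bounded_mono[OF f]) (use s in auto)
    let ?\<phi> = "\<lambda>t y. indicator {0<..<t} y * f y"
    let ?\<psi> = "\<lambda>y. ?\<phi> t y - ?\<phi> s y"
    have m[measurable]: "?\<phi> t \<in> borel_measurable borel" "?\<phi> s \<in> borel_measurable borel"
      using cutoff_measurable[OF f] cutoff_measurable[OF fs] a by auto
    have m\<psi>: "?\<psi> \<in> borel_measurable borel" by measurable
    have \<psi>: "?\<psi> y = indicator {s<..<t} y * f y" if "0 < y" "y \<noteq> s" "y \<noteq> t" for y
      using that s by (auto simp: indicator_def)
    note mw[measurable] = weyl_left_measurable[OF m(1), of \<alpha> 0] weyl_left_measurable[OF m(2), of \<alpha> 0]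
      weyl_left_measurable[OF m\<psi>, of \<alpha> 0]
    have it: "set_integrable lborel {0<..<T} (weyl_left \<alpha> 0 (?\<phi> t))"
      by (rule weyl_left_integrable(1)[where s=0, OF _ _ _ a f H _ m(1)]) (use s in auto)
    have i_s: "set_integrable lborel {0<..<T} (weyl_left \<alpha> 0 (?\<phi> s))"
      by (rule weyl_left_integrable(1)[where s=0, OF _ _ _ a fs H _ m(2)]) (use s in auto)
    note w\<psi> = weyl_left_integrable[OF s a f H \<psi> m\<psi>]
    have gen: "\<bar>p * q\<bar> \<le> L * \<bar>p\<bar>" if "\<bar>q\<bar> \<le> L" for p q :: real
      using mult_left_mono[OF that abs_ge_zero[of p]] by (simp add: abs_mult mult.commute)
    have prod: "integrable lborel (\<lambda>x. indicator {0<..<T} x * weyl_left \<alpha> 0 h x * ?d x)"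
      if "set_integrable lborel {0<..<T} (weyl_left \<alpha> 0 h)" "h \<in> borel_measurable borel" for h
    proof (rule Bochner_Integration.integrable_bound)
      show "integrable lborel (\<lambda>x. L * (indicator {0<..<T} x * weyl_left \<alpha> 0 h x))"
        using that by (simp add: set_integrable_def)
      show "(\<lambda>x. indicator {0<..<T} x * weyl_left \<alpha> 0 h x * ?d x) \<in> borel_measurable lborel"
        using weyl_left_measurable[OF that(2), of \<alpha> 0] by measurable
      show "AE x in lborel. norm (indicator {0<..<T} x * weyl_left \<alpha> 0 h x * ?d x)
          \<le> norm (L * (indicator {0<..<T} x * weyl_left \<alpha> 0 h x))"
        by (rule AE_I2) (simp only: real_norm_def abs_mult[of L] abs_of_nonneg[OF L(1)] gen[OF L'])
    qed
    have J: "gls_integral_sub \<alpha> 0 T 0 u f g = - (\<integral>x. indicator {0<..<T} x * weyl_left \<alpha> 0 (?\<phi> u) x * ?d x \<partial>lborel)" for u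
      unfolding gls_integral_sub_def gls_integral_dual_kernel set_lebesgue_integral_def
      by (intro arg_cong[of _ _ uminus] Bochner_Integration.integral_cong) (auto simp: indicator_def)
    have "gls_integral_sub \<alpha> 0 T 0 t f g - gls_integral_sub \<alpha> 0 T 0 s f g =
      - (\<integral>x. indicator {0<..<T} x * weyl_left \<alpha> 0 (?\<phi> t) x * ?d x
          - indicator {0<..<T} x * weyl_left \<alpha> 0 (?\<phi> s) x * ?d x \<partial>lborel)"
      unfolding J using prod[OF it m(1)] prod[OF i_s m(2)] by simp
    \<comment> \<open>Linearity is used only off s and t, where the inner integrals are known to
      converge; the exceptional points are a null set.\<close>
    also have "\<dots> = - (\<integral>x. indicator {0<..<T} x * weyl_left \<alpha> 0 ?\<psi> x * ?d x \<partial>lborel)"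
    proof (intro arg_cong[of _ _ uminus] integral_cong_AE)
      show "AE x in lborel. indicator {0<..<T} x * weyl_left \<alpha> 0 (?\<phi> t) x * ?d x
          - indicator {0<..<T} x * weyl_left \<alpha> 0 (?\<phi> s) x * ?d x
          = indicator {0<..<T} x * weyl_left \<alpha> 0 ?\<psi> x * ?d x"
        using AE_lborel_neq[of s] AE_lborel_neq[of t]
      proof eventually_elim
        case (elim x)
        show ?case
        proof (cases "x \<in> {0<..<T}")
          case True
          have "set_integrable lborel {0<..<x} (\<lambda>y. (?\<phi> t x - ?\<phi> t y) / (x - y) powr (\<alpha> + 1))"
            by (intro weyl_left_bump(1)[of 0 t T \<alpha> \<delta> f M H])
              (use True s a elim m holder_boundedD[OF f] H in auto)
          moreover have "set_integrable lborel {0<..<x} (\<lambda>y. (?\<phi> s x - ?\<phi> s y) / (x - y) powr (\<alpha> + 1))"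
            by (intro weyl_left_bump(1)[of 0 s T \<alpha> \<delta> f M H])
              (use True s a elim m holder_boundedD[OF fs] H in auto)
          ultimately show ?thesis by (simp add: weyl_left_diff algebra_simps)
        qed auto
      qed
    qed measurable
    finally have "\<bar>gls_integral_sub \<alpha> 0 T 0 t f g - gls_integral_sub \<alpha> 0 T 0 s f g\<bar> \<le>
       (\<integral>x. \<bar>indicator {0<..<T} x * weyl_left \<alpha> 0 ?\<psi> x * ?d x\<bar> \<partial>lborel)"
      using integral_norm_bound[of lborel "\<lambda>x. indicator {0<..<T} x * weyl_left \<alpha> 0 ?\<psi> x * ?d x"]
      by (simp del: abs_mult)
    also have "\<dots> \<le> (\<integral>x. L * \<bar>indicator {0<..<T} x * weyl_left \<alpha> 0 ?\<psi> x\<bar> \<partial>lborel)"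
    proof (rule integral_mono)
      show "integrable lborel (\<lambda>x. \<bar>indicator {0<..<T} x * weyl_left \<alpha> 0 ?\<psi> x * ?d x\<bar>)"
        using prod[OF w\<psi>(1) m\<psi>] by (rule integrable_abs)
      show "integrable lborel (\<lambda>x. L * \<bar>indicator {0<..<T} x * weyl_left \<alpha> 0 ?\<psi> x\<bar>)"
        using w\<psi>(1) unfolding set_integrable_def real_scaleR_def
        by (intro integrable_mult_right integrable_abs)
      show "\<bar>indicator {0<..<T} x * weyl_left \<alpha> 0 ?\<psi> x * ?d x\<bar> \<le> L * \<bar>indicator {0<..<T} x * weyl_left \<alpha> 0 ?\<psi> x\<bar>" for x
        by (rule gen[OF L'])
    qed
    also have "\<dots> = L * (\<integral>x. \<bar>indicator {0<..<T} x * weyl_left \<alpha> 0 ?\<psi> x\<bar> \<partial>lborel)" by simp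
    also have "\<dots> \<le> L * (2 / (Gamma (1 - \<alpha>) * (1 - \<alpha>)) * (M + c * H) * (t - s) powr (1 - \<alpha>))"
      unfolding c_def using L by (intro mult_left_mono w\<psi>(2)) auto
    also have "\<dots> = K * ((M + c * H) * (t - s) powr (1 - \<alpha>))" by (simp add: K_def)
    also have "\<dots> \<le> K * ((1 + c) * (M + H) * (t - s) powr (1 - \<alpha>))"
    proof -
      have "M + c * H \<le> (1 + c) * (M + H)" using c0 M0 H by (simp add: algebra_simps)
      then show ?thesis using K0 by (intro mult_left_mono mult_right_mono) auto
    qed
    finally show "\<bar>gls_integral_sub \<alpha> 0 T 0 t f g - gls_integral_sub \<alpha> 0 T 0 s f g\<bar> \<le>
      K * (1 + c) * (M + H) * (t - s) powr (1 - \<alpha>)" by (simp add: mult.assoc)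
  qed
qed

text \<open>Dominated convergence is applied twice: to the inner integral at fixed x, and then to
  the integral over x. The common constants M and H make both majorants independent of n.\<close>

lemma gls_integral_sub_tendsto:
  assumes W: "W_space \<alpha> T g" and T: "0 < T" and a: "0 < \<alpha>" "\<alpha> < 1" "\<alpha> < \<delta>" "\<delta> \<le> 1"
    and t: "0 \<le> t" "t \<le> T" and H: "0 \<le> H"
    and fn: "\<And>n. holder_bounded \<delta> M H {0..t} (F n)" and f: "holder_bounded \<delta> M H {0..t} f"
    and conv: "\<And>s. s \<in> {0..t} \<Longrightarrow> (\<lambda>n. F n s) \<longlonglongrightarrow> f s"
  shows "(\<lambda>n. gls_integral_sub \<alpha> 0 T 0 t (F n) g) \<longlonglongrightarrow> gls_integral_sub \<alpha> 0 T 0 t f g"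
proof -
  let ?\<phi> = "\<lambda>f y. indicator {0<..<t} y * f y"
  let ?d = "\<lambda>x. indicator {0<..<T} x * dual_kernel \<alpha> T g x"
  let ?w = "\<lambda>x. 1 / Gamma (1 - \<alpha>) * ((M + \<alpha> * (1 + T) / (\<delta> - \<alpha>) * H) * bump_weight \<alpha> T 0 t x)"
  note D = dual_kernel_bounded[OF W T a(1,2)]
  note [measurable] = D(3)
  obtain L where L: "0 \<le> L" "\<And>x. x \<in> {0<..<T} \<Longrightarrow> \<bar>dual_kernel \<alpha> T g x\<bar> \<le> L" using D(4) by blast
  have L': "\<bar>?d x\<bar> \<le> L" for x using L by (auto simp: indicator_def)
  have mn[measurable]: "?\<phi> (F n) \<in> borel_measurable borel" for n
    using cutoff_measurable[OF fn] a by simp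
  have m[measurable]: "?\<phi> f \<in> borel_measurable borel" using cutoff_measurable[OF f] a by simp
  note mw[measurable] = weyl_left_measurable[OF m, of \<alpha> 0] weyl_left_measurable[OF mn, of \<alpha> 0]
  have wbd: "\<bar>weyl_left \<alpha> 0 (?\<phi> (F n)) x\<bar> \<le> ?w x" if "0 < x" "x < T" "x \<noteq> t" for n x
    by (rule weyl_left_bump(2)[where f="F n", OF _ t a _ _ H _ mn])
      (use that t holder_boundedD[OF fn] in auto)
  have wconv: "(\<lambda>n. weyl_left \<alpha> 0 (?\<phi> (F n)) x) \<longlonglongrightarrow> weyl_left \<alpha> 0 (?\<phi> f) x"
    if x: "0 < x" "x < T" "x \<noteq> t" for x
  proof -
    let ?B = "bump_kernel \<alpha> \<delta> M H 0 t x"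
    have \<phi>c: "(\<lambda>n. ?\<phi> (F n) y) \<longlonglongrightarrow> ?\<phi> f y" for y
      using conv[of y] by (cases "y \<in> {0<..<t}") auto
    have M0: "0 \<le> M" using holder_boundedD(1)[OF f, of t] t by force
    have B0: "?B y \<ge> 0" for y using M0 H by (auto simp: bump_kernel_def)
    have bound: "AE y in lborel. norm (indicator {0<..<x} y *\<^sub>R ((?\<phi> (F n) x - ?\<phi> (F n) y) / (x - y) powr (\<alpha> + 1))) \<le> ?B y" for n
      using AE_lborel_neq[of 0] AE_lborel_neq[of t]
    proof eventually_elim
      case (elim y)
      have *: "\<bar>(?\<phi> (F n) x - ?\<phi> (F n) y) / (x - y) powr (\<alpha> + 1)\<bar> \<le> ?B y" if "y \<in> {0<..<x}"
        by (rule bump_kernel_bound[where f="F n"]) (use elim that t x holder_boundedD[OF fn] in auto)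
      show ?case
      proof (cases "y \<in> {0<..<x}")
        case True
        then show ?thesis using * by simp
      next
        case False
        then show ?thesis using B0[of y] by simp
      qed
    qed
    have "(\<lambda>n. LINT y:{0<..<x}|lborel. (?\<phi> (F n) x - ?\<phi> (F n) y) / (x - y) powr (\<alpha> + 1))
        \<longlonglongrightarrow> (LINT y:{0<..<x}|lborel. (?\<phi> f x - ?\<phi> f y) / (x - y) powr (\<alpha> + 1))"
      unfolding set_lebesgue_integral_def
    proof (rule integral_dominated_convergence[where w="?B"])
      show "integrable lborel ?B" by (rule integrable_bump_kernel) (use t a x in auto)
      show "AE y in lborel. (\<lambda>n. indicator {0<..<x} y *\<^sub>R ((?\<phi> (F n) x - ?\<phi> (F n) y) / (x - y) powr (\<alpha> + 1)))
         \<longlonglongrightarrow> indicator {0<..<x} y *\<^sub>R ((?\<phi> f x - ?\<phi> f y) / (x - y) powr (\<alpha> + 1))"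
      proof (rule AE_I2)
        fix y
        show "(\<lambda>n. indicator {0<..<x} y *\<^sub>R ((?\<phi> (F n) x - ?\<phi> (F n) y) / (x - y) powr (\<alpha> + 1)))
         \<longlonglongrightarrow> indicator {0<..<x} y *\<^sub>R ((?\<phi> f x - ?\<phi> f y) / (x - y) powr (\<alpha> + 1))"
        proof (cases "y \<in> {0<..<x}")
          case True
          then show ?thesis by (intro tendsto_intros \<phi>c) auto
        qed auto
      qed
    qed (use bound in \<open>measurable\<close>)
    then show ?thesis unfolding weyl_left_def
      using x by (intro tendsto_intros \<phi>c) auto
  qed
  have J: "gls_integral_sub \<alpha> 0 T 0 t f g = - (\<integral>x. indicator {0<..<T} x * weyl_left \<alpha> 0 (?\<phi> f) x * ?d x \<partial>lborel)" for f
    unfolding gls_integral_sub_def gls_integral_dual_kernel set_lebesgue_integral_def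
    by (intro arg_cong[of _ _ uminus] Bochner_Integration.integral_cong) (auto simp: indicator_def)
  have "(\<lambda>n. \<integral>x. indicator {0<..<T} x * weyl_left \<alpha> 0 (?\<phi> (F n)) x * ?d x \<partial>lborel)
     \<longlonglongrightarrow> (\<integral>x. indicator {0<..<T} x * weyl_left \<alpha> 0 (?\<phi> f) x * ?d x \<partial>lborel)"
  \<comment> \<open>The bump weight with s = 0 dominates all left derivatives, and L bounds the
    kernel of g.\<close>
  proof (rule integral_dominated_convergence[where w="\<lambda>x. ?w x * L"])
    show "integrable lborel (\<lambda>x. ?w x * L)"
      using bump_weight_integral(1)[of 0 t T \<alpha>] t a by simp
    show "AE x in lborel. (\<lambda>n. indicator {0<..<T} x * weyl_left \<alpha> 0 (?\<phi> (F n)) x * ?d x)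
       \<longlonglongrightarrow> indicator {0<..<T} x * weyl_left \<alpha> 0 (?\<phi> f) x * ?d x"
      using AE_lborel_neq[of t]
    proof eventually_elim
      case (elim x)
      then show ?case by (cases "x \<in> {0<..<T}") (auto intro!: tendsto_intros wconv)
    qed
    show "AE x in lborel. norm (indicator {0<..<T} x * weyl_left \<alpha> 0 (?\<phi> (F n)) x * ?d x) \<le> ?w x * L" for n
      using AE_lborel_neq[of t] AE_lborel_neq[of 0] AE_lborel_neq[of T]
    proof eventually_elim
      case (elim x)
      show ?case
      proof (cases "x \<in> {0<..<T}")
        case True
        then have "\<bar>weyl_left \<alpha> 0 (?\<phi> (F n)) x\<bar> * \<bar>?d x\<bar> \<le> ?w x * L"
          using wbd[of x n] elim L'[of x] L by (intro mult_mono order_trans[OF abs_ge_zero wbd[of x n]]) auto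
        then show ?thesis using True by (simp add: abs_mult)
      next
        case False
        then have "bump_weight \<alpha> T 0 t x = 0"
          using elim t by (auto simp: bump_weight_def indicator_def)
        then show ?thesis using False by auto
      qed
    qed
  qed measurable
  then show ?thesis unfolding J by (rule tendsto_minus)
qed

section \<open>Hoelder paths and the regulator\<close>

lemma integrable_indicator_interval:
  "integrable lborel (indicator {p..q::real} :: real \<Rightarrow> real)"
  "integrable lborel (indicator {p<..q::real} :: real \<Rightarrow> real)"
  using emeasure_bounded_finite[of "{p..q}"] emeasure_bounded_finite[of "{p<..q}"]
  by (auto intro!: integrable_real_indicator)

lemma holder_bounded_limit:
  assumes "\<And>n. holder_bounded \<mu> M H S (F n)" "\<And>s. s \<in> S \<Longrightarrow> (\<lambda>n. F n s) \<longlonglongrightarrow> f s"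
  shows "holder_bounded \<mu> M H S f"
  unfolding holder_bounded_def
proof (intro conjI ballI)
  fix s t assume s: "s \<in> S" "t \<in> S"
  show "\<bar>f s\<bar> \<le> M"
    by (rule LIMSEQ_le_const2[OF tendsto_rabs[OF assms(2)[OF s(1)]]])
      (use holder_boundedD[OF assms(1)] s in blast)
  show "\<bar>f s - f t\<bar> \<le> H * \<bar>s - t\<bar> powr \<mu>"
    by (rule LIMSEQ_le_const2[OF tendsto_rabs[OF tendsto_diff[OF assms(2)[OF s(1)] assms(2)[OF s(2)]]]])
      (use holder_boundedD[OF assms(1)] s in blast)
qed

text \<open>An increment across t0 is split there and each half costs at most a (q - p)^\<mu>, hence
  the factor 2. The sup bound grows by at most a because the added interval has length at most
  1.\<close>

lemma holder_bounded_extend: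
  assumes X: "holder_bounded \<mu> a a {..t0} X" and a: "0 \<le> a" and \<mu>: "0 < \<mu>"
    and t: "t0 \<le> t1" "t1 - t0 \<le> 1"
    and inc: "\<And>p q. t0 \<le> p \<Longrightarrow> p \<le> q \<Longrightarrow> q \<le> t1 \<Longrightarrow> \<bar>X q - X p\<bar> \<le> a * (q - p) powr \<mu>"
  shows "holder_bounded \<mu> (2 * a) (2 * a) {..t1} X"
proof -
  have sup: "\<bar>X s\<bar> \<le> 2 * a" if "s \<le> t1" for s
  proof (cases "s \<le> t0")
    case True
    then show ?thesis using holder_boundedD(1)[OF X, of s] a by simp
  next
    case False
    then have "\<bar>X s - X t0\<bar> \<le> a * (s - t0) powr \<mu>" using inc[of t0 s] that by simp
    also have "\<dots> \<le> a * 1"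
      using a \<mu> False that t by (intro mult_left_mono powr_le1) auto
    finally show ?thesis using holder_boundedD(1)[OF X, of t0] by simp
  qed
  have diff: "\<bar>X q - X p\<bar> \<le> 2 * a * (q - p) powr \<mu>" if "p \<le> q" "q \<le> t1" for p q
  proof -
    have nn: "0 \<le> a * (q - p) powr \<mu>" using a by simp
    consider "q \<le> t0" | "t0 \<le> p" | "p < t0" "t0 < q" by linarith
    then show ?thesis
    proof cases
      case 1
      then show ?thesis using holder_boundedD(2)[OF X, of q p] that nn by simp
    next
      case 2
      then show ?thesis using inc[of p q] that nn by simp
    next
      case 3
      have "\<bar>X t0 - X p\<bar> \<le> a * (t0 - p) powr \<mu>" using holder_boundedD(2)[OF X, of t0 p] 3 by simp
      moreover have "\<bar>X q - X t0\<bar> \<le> a * (q - t0) powr \<mu>" using inc[of t0 q] 3 that by simp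
      moreover have "a * (t0 - p) powr \<mu> \<le> a * (q - p) powr \<mu>"
        "a * (q - t0) powr \<mu> \<le> a * (q - p) powr \<mu>"
        using 3 a \<mu> by (intro mult_left_mono powr_mono2; simp)+
      ultimately show ?thesis by linarith
    qed
  qed
  show ?thesis unfolding holder_bounded_def
  proof (intro conjI ballI)
    fix p q assume "p \<in> {..t1}" "q \<in> {..t1}"
    then show "\<bar>X p - X q\<bar> \<le> 2 * a * \<bar>p - q\<bar> powr \<mu>"
      using diff[of p q] diff[of q p] by (cases "p \<le> q") (auto simp: abs_minus_commute)
  qed (use sup in auto)
qed

lemma segment_norm_le:
  assumes "r > 0" "continuous_on {t-r..t} x" "\<And>s. s \<in> {t-r..t} \<Longrightarrow> \<bar>x s\<bar> \<le> A"
  shows "norm (segment r x t) \<le> A"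
proof (rule norm_bound)
  fix s
  show "norm (apply_bcontfun (segment r x t) s) \<le> A"
    using assms(1) assms(3)[of "t + max (-r) (min s 0)"] Bcontfun_inverse[OF segment_bcontfun[OF assms(1,2)]]
    by (simp add: segment_def)
qed

lemma segment_diff_norm_le:
  assumes "r > 0" "continuous_on {s-r..s} x" "continuous_on {t-r..t} y"
    "\<And>w. w \<in> {-r..0} \<Longrightarrow> \<bar>x (s + w) - y (t + w)\<bar> \<le> A"
  shows "norm (segment r x s - segment r y t) \<le> A"
proof (rule norm_bound)
  fix w
  show "norm (apply_bcontfun (segment r x s - segment r y t) w) \<le> A"
    using assms(1) assms(4)[of "max (-r) (min w 0)"] Bcontfun_inverse[OF segment_bcontfun[OF assms(1,2)]]
      Bcontfun_inverse[OF segment_bcontfun[OF assms(1,3)]]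
    by (simp add: segment_def minus_bcontfun.rep_eq)
qed

lemma segment_cong:
  assumes "r > 0" "\<And>s. s \<le> t \<Longrightarrow> x s = y s"
  shows "segment r x t = segment r y t"
  unfolding segment_def using assms by (intro arg_cong[of _ _ Bcontfun] ext) auto

text \<open>A running supremum is 1-Lipschitz in the uniform norm. The boundedness conditions ensure
  that both suprema are genuine.\<close>

lemma regulator_perturb:
  assumes "0 \<le> t" "\<And>s. s \<in> {0..t} \<Longrightarrow> \<bar>z s - w s\<bar> \<le> e"
    and z: "bdd_above ((\<lambda>s. max (- z s) 0) ` {0..t})" and w: "bdd_above ((\<lambda>s. max (- w s) 0) ` {0..t})"
  shows "\<bar>regulator z t - regulator w t\<bar> \<le> e"
proof -
  have "regulator z t \<le> regulator w t + e"
    unfolding regulator_def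
  proof (rule cSUP_least)
    fix s assume s: "s \<in> {0..t}"
    show "max (- z s) 0 \<le> (SUP s\<in>{0..t}. max (- w s) 0) + e"
      using cSUP_upper[OF s w] assms(2)[OF s] by linarith
  qed (use assms in auto)
  moreover have "regulator w t \<le> regulator z t + e"
    unfolding regulator_def
  proof (rule cSUP_least)
    fix s assume s: "s \<in> {0..t}"
    show "max (- w s) 0 \<le> (SUP s\<in>{0..t}. max (- z s) 0) + e"
      using cSUP_upper[OF s z] assms(2)[OF s] by linarith
  qed (use assms in auto)
  ultimately show ?thesis by linarith
qed

text \<open>After time s the supremum can rise only by the amount by which -z exceeds its value at
  s, and that value is already counted in the regulator at s.\<close>

lemma regulator_increment:
  assumes t: "0 \<le> s" "s \<le> t" and bdd: "bdd_above ((\<lambda>s. max (- z s) 0) ` {0..t})"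
    and e: "0 \<le> e" "\<And>w. s \<le> w \<Longrightarrow> w \<le> t \<Longrightarrow> \<bar>z w - z s\<bar> \<le> e"
  shows "\<bar>regulator z t - regulator z s\<bar> \<le> e"
proof -
  have bs: "bdd_above ((\<lambda>s. max (- z s) 0) ` {0..s})"
    by (rule bdd_above_mono[OF bdd]) (use t in auto)
  have "regulator z s \<le> regulator z t"
    unfolding regulator_def by (rule cSUP_subset_mono[OF _ bdd]) (use t in auto)
  moreover have "regulator z t \<le> regulator z s + e"
    unfolding regulator_def
  proof (rule cSUP_least)
    fix w assume w: "w \<in> {0..t}"
    show "max (- z w) 0 \<le> (SUP s\<in>{0..s}. max (- z s) 0) + e"
    proof (cases "w \<le> s")
      case True
      then show ?thesis using cSUP_upper[of w "{0..s}", OF _ bs] w e(1) by simp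
    next
      case False
      then show ?thesis using cSUP_upper[of s "{0..s}", OF _ bs] t e(2)[of w] w e(1) by fastforce
    qed
  qed (use t in auto)
  ultimately show ?thesis by linarith
qed

section \<open>Coefficients and free process along Hoelder paths\<close>

locale reflected_delay_equation =
  fixes T r \<theta> \<alpha> \<beta> :: real and \<eta> g :: "real \<Rightarrow> real"
    and b \<sigma> :: "real \<Rightarrow> (real \<Rightarrow>\<^sub>C real) \<Rightarrow> real"
  assumes T: "0 < T" and r: "0 < r" and \<theta>: "0 < \<theta>" "\<theta> \<le> 1"
    and \<eta>_nonneg: "\<forall>s\<in>{-r..0}. \<eta> s \<ge> 0" and \<eta>_holder: "holder_on \<theta> {-r..0} \<eta>"
    and drift: "drift_coeff T r b"
    and \<beta>: "0 < \<beta>" "\<beta> < 1" and diffusion: "diffusion_coeff T r \<beta> \<sigma>"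
    and \<alpha>: "0 < \<alpha>" "\<alpha> < min (1/2) (min \<theta> \<beta>)" and W: "W_space \<alpha> T g"
begin

definition "\<gamma> = min \<theta> (1/2)"

text \<open>One constant bounds both the sup norm and the Hoelder quotient. The domain is a
  half-line, so the bound is preserved when the path is delayed.\<close>

abbreviation path_bound :: "real \<Rightarrow> real \<Rightarrow> (real \<Rightarrow> real) \<Rightarrow> bool" where
  "path_bound A t \<equiv> holder_bounded \<gamma> A A {..t}"

abbreviation Z where "Z \<equiv> free_process \<alpha> T r \<eta> b \<sigma> g"

text \<open>Two of these carry the proof: \<alpha> < \<open>min \<beta> \<gamma>\<close> says that s
  -> \<sigma>(s, x_s) is regular enough for the derivative of order \<alpha>, and \<gamma> < 1 -
  \<alpha> says that integration gains regularity.\<close>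

lemma \<gamma>: "0 < \<gamma>" "\<gamma> \<le> 1/2" "\<alpha> < \<gamma>" "\<alpha> < 1" "\<gamma> < 1 - \<alpha>" "\<alpha> < min \<beta> \<gamma>" "min \<beta> \<gamma> \<le> 1" "0 < min \<beta> \<gamma>"
  using \<theta> \<alpha> \<beta> by (auto simp: \<gamma>_def)

lemma path_bound_continuous: "path_bound A t u \<Longrightarrow> S \<subseteq> {..t} \<Longrightarrow> continuous_on S u"
  using holder_bounded_imp_continuous_on \<gamma>(1) continuous_on_subset by blast

lemma powr_le_powr_horizon:
  assumes "0 \<le> d" "d \<le> T" "\<mu> \<le> \<nu>" "\<nu> - \<mu> \<le> 1"
  shows "d powr \<nu> \<le> (1 + T) * d powr \<mu>"
proof -
  have "d powr \<nu> = d powr (\<nu> - \<mu>) * d powr \<mu>" by (simp flip: powr_add)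
  moreover have "d powr (\<nu> - \<mu>) \<le> (1 + T) powr (\<nu> - \<mu>)" using assms by (intro powr_mono2) auto
  moreover have "(1 + T) powr (\<nu> - \<mu>) \<le> (1 + T) powr 1" using assms T by (intro powr_mono) auto
  ultimately show ?thesis using T by (simp add: mult_right_mono)
qed

lemma segment_bounds:
  assumes u: "path_bound A t u" and s: "s \<le> t"
  shows "segment r u s \<in> path_space r" "norm (segment r u s) \<le> A"
    and "s' \<le> t \<Longrightarrow> norm (segment r u s - segment r u s') \<le> A * \<bar>s - s'\<bar> powr \<gamma>"
proof -
  have c: "continuous_on {s-r..s} u" if "s \<le> t" for s
    using path_bound_continuous[OF u, of "{s-r..s}"] that by auto
  show "segment r u s \<in> path_space r" by (rule segment_in_path_space[OF r c[OF s]])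
  show "norm (segment r u s) \<le> A"
    by (rule segment_norm_le[OF r c[OF s]]) (use holder_boundedD(1)[OF u] s in auto)
  show "norm (segment r u s - segment r u s') \<le> A * \<bar>s - s'\<bar> powr \<gamma>" if s': "s' \<le> t"
  proof (rule segment_diff_norm_le[OF r c[OF s] c[OF s']])
    fix w assume "w \<in> {-r..0}"
    then show "\<bar>u (s + w) - u (s' + w)\<bar> \<le> A * \<bar>s - s'\<bar> powr \<gamma>"
      using holder_boundedD(2)[OF u, of "s + w" "s' + w"] s s' by simp
  qed
qed

text \<open>The increment splits into a change of time, of order \<beta> with factor 1 + A, and a
  change of segment, of order \<gamma> with factor A. That the constants grow only linearly in A is
  what later makes the step length independent of the size of the path.\<close>

lemma diffusion_holder:
  obtains L where "0 \<le> L"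
    and "\<And>u A t. path_bound A t u \<Longrightarrow> 0 \<le> A \<Longrightarrow> t \<le> T \<Longrightarrow>
      holder_bounded (min \<beta> \<gamma>) (L * (1 + A)) (L * (1 + A)) {0..t} (\<lambda>s. \<sigma> s (segment r u s))"
proof -
  obtain L1 L2 L3 where
    L1: "\<And>t \<phi>. t \<in> {0..T} \<Longrightarrow> \<phi> \<in> path_space r \<Longrightarrow> \<bar>\<sigma> t \<phi>\<bar> \<le> L1 * (1 + norm \<phi>)"
    and L2: "\<And>t s \<phi>. t \<in> {0..T} \<Longrightarrow> s \<in> {0..T} \<Longrightarrow> \<phi> \<in> path_space r \<Longrightarrow>
        \<bar>\<sigma> t \<phi> - \<sigma> s \<phi>\<bar> \<le> L2 * \<bar>t - s\<bar> powr \<beta> * (1 + norm \<phi>)"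
    and L3: "\<And>t \<phi> \<psi>. t \<in> {0..T} \<Longrightarrow> \<phi> \<in> path_space r \<Longrightarrow> \<psi> \<in> path_space r \<Longrightarrow>
        \<bar>\<sigma> t \<phi> - \<sigma> t \<psi>\<bar> \<le> L3 * norm (\<phi> - \<psi>)"
    using diffusion unfolding diffusion_coeff_def by metis
  define L where "L = \<bar>L1\<bar> + (1 + T) * (\<bar>L2\<bar> + \<bar>L3\<bar>)"
  show thesis
  proof
    show "0 \<le> L" using T by (simp add: L_def)
    fix u A t assume u: "path_bound A t u" and A: "0 \<le> A" and t: "t \<le> T"
    show "holder_bounded (min \<beta> \<gamma>) (L * (1 + A)) (L * (1 + A)) {0..t} (\<lambda>s. \<sigma> s (segment r u s))"
      unfolding holder_bounded_def
    proof (intro conjI ballI)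
      fix s assume s: "s \<in> {0..t}"
      note S = segment_bounds[OF u, of s]
      have "\<bar>\<sigma> s (segment r u s)\<bar> \<le> L1 * (1 + norm (segment r u s))" using L1 S s t by auto
      also have "\<dots> \<le> \<bar>L1\<bar> * (1 + A)" using S s by (intro mult_mono) auto
      also have "\<dots> \<le> L * (1 + A)" using A T by (intro mult_right_mono) (auto simp: L_def)
      finally show "\<bar>\<sigma> s (segment r u s)\<bar> \<le> L * (1 + A)" .
      fix s' assume s': "s' \<in> {0..t}"
      note S' = segment_bounds[OF u, of s']
      let ?d = "\<bar>s - s'\<bar> powr (min \<beta> \<gamma>)"
      have d: "\<bar>s - s'\<bar> powr \<beta> \<le> (1 + T) * ?d" "\<bar>s - s'\<bar> powr \<gamma> \<le> (1 + T) * ?d"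
        using s s' t \<gamma> \<beta> by (intro powr_le_powr_horizon; force)+
      have "\<bar>\<sigma> s (segment r u s) - \<sigma> s' (segment r u s)\<bar> \<le> L2 * \<bar>s - s'\<bar> powr \<beta> * (1 + norm (segment r u s))"
        using L2 S s s' t by auto
      also have "\<dots> \<le> \<bar>L2\<bar> * ((1 + T) * ?d) * (1 + A)" using S s d(1) T by (intro mult_mono) auto
      finally have 1: "\<bar>\<sigma> s (segment r u s) - \<sigma> s' (segment r u s)\<bar> \<le> \<bar>L2\<bar> * ((1 + T) * ?d) * (1 + A)" .
      have "\<bar>\<sigma> s' (segment r u s) - \<sigma> s' (segment r u s')\<bar> \<le> L3 * norm (segment r u s - segment r u s')"
        using L3 S S' s s' t by auto
      also have "\<dots> \<le> \<bar>L3\<bar> * ((1 + A) * ((1 + T) * ?d))"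
      proof (intro mult_mono)
        have "norm (segment r u s - segment r u s') \<le> A * \<bar>s - s'\<bar> powr \<gamma>" using S(3) s s' by auto
        also have "\<dots> \<le> (1 + A) * ((1 + T) * ?d)" using A d(2) by (intro mult_mono) auto
        finally show "norm (segment r u s - segment r u s') \<le> (1 + A) * ((1 + T) * ?d)" .
      qed auto
      finally have "\<bar>\<sigma> s (segment r u s) - \<sigma> s' (segment r u s')\<bar> \<le>
        \<bar>L2\<bar> * ((1 + T) * ?d) * (1 + A) + \<bar>L3\<bar> * ((1 + A) * ((1 + T) * ?d))" using 1 by linarith
      also have "\<dots> = (1 + T) * (\<bar>L2\<bar> + \<bar>L3\<bar>) * (1 + A) * ?d" by (simp add: algebra_simps)
      also have "\<dots> \<le> L * (1 + A) * ?d" using A by (intro mult_right_mono) (auto simp: L_def)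
      finally show "\<bar>\<sigma> s (segment r u s) - \<sigma> s' (segment r u s')\<bar> \<le> L * (1 + A) * ?d" .
    qed
  qed
qed

lemma drift_bounds:
  obtains L where "0 \<le> L"
    and "\<And>u A t. path_bound A t u \<Longrightarrow> t \<le> T \<Longrightarrow>
      set_integrable lborel {0..t} (\<lambda>s. b s (segment r u s))"
    and "\<And>u A t s. path_bound A t u \<Longrightarrow> t \<le> T \<Longrightarrow> s \<in> {0..t} \<Longrightarrow> \<bar>b s (segment r u s)\<bar> \<le> L * (1 + A)"
proof -
  have meas: "(\<lambda>(t, \<phi>). b t \<phi>) \<in> borel_measurable
        (restrict_space borel {0..T} \<Otimes>\<^sub>M restrict_space borel (path_space r))"
    using drift by (simp add: drift_coeff_def)
  obtain L where L: "\<And>t \<phi>. t \<in> {0..T} \<Longrightarrow> \<phi> \<in> path_space r \<Longrightarrow> \<bar>b t \<phi>\<bar> \<le> L * (1 + norm \<phi>)"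
    using drift unfolding drift_coeff_def by metis
  have bd: "\<bar>b s (segment r u s)\<bar> \<le> \<bar>L\<bar> * (1 + A)" if u: "path_bound A t u" and t: "t \<le> T" "s \<in> {0..t}"
    for u A t s
  proof -
    note S = segment_bounds[OF u, of s]
    have "\<bar>b s (segment r u s)\<bar> \<le> L * (1 + norm (segment r u s))" using L S t by auto
    also have "\<dots> \<le> \<bar>L\<bar> * (1 + A)" using S t by (intro mult_mono) auto
    finally show ?thesis .
  qed
  have int: "set_integrable lborel {0..t} (\<lambda>s. b s (segment r u s))"
    if u: "path_bound A t u" and t: "t \<le> T" for u A t
  proof -
    \<comment> \<open>The path is Hoelder, so its segment map is continuous in the sup norm; with
      the joint measurability of b this makes s -> b(s, x_s) measurable.\<close>
    have c: "continuous_on {0..t} (segment r u)"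
      by (rule holder_imp_continuous_on[where H=A and \<mu>=\<gamma>])
        (use segment_bounds(3)[OF u] \<gamma>(1) in \<open>auto simp: dist_norm\<close>)
    have "segment r u \<in> measurable (restrict_space borel {0..t}) (restrict_space borel (path_space r))"
      by (rule measurable_restrict_space2)
        (use segment_bounds(1)[OF u] borel_measurable_continuous_on_restrict[OF c]
          in \<open>auto simp: space_restrict_space\<close>)
    moreover have "(\<lambda>s. s) \<in> measurable (restrict_space borel {0..t}) (restrict_space borel {0..T})"
      by (rule measurable_restrict_space2) (use t in \<open>auto simp: space_restrict_space intro!: measurable_restrict_space1\<close>)
    ultimately have "(\<lambda>s. (s, segment r u s)) \<in> measurable (restrict_space borel {0..t})
        (restrict_space borel {0..T} \<Otimes>\<^sub>M restrict_space borel (path_space r))"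
      by (intro measurable_Pair)
    from measurable_compose[OF this meas]
    have "(\<lambda>s. b s (segment r u s)) \<in> borel_measurable (restrict_space borel {0..t})" by simp
    then have m: "set_borel_measurable lborel {0..t} (\<lambda>s. b s (segment r u s))"
      by (simp add: borel_measurable_restrict_space_iff set_borel_measurable_def)
    show ?thesis
      by (rule set_integrable_bound[OF _ m, of "\<lambda>_. \<bar>L\<bar> * (1 + A)"])
        (use bd[OF u t] integrable_indicator_interval in \<open>auto simp: set_integrable_def intro: order_trans[OF _ abs_ge_self]\<close>)
  qed
  show thesis by (rule that[of "\<bar>L\<bar>"]) (use int bd in auto)
qed

lemma free_process_0: "Z u 0 = \<eta> 0"
proof -
  have "(LINT s:{0..0}|lborel. b s (segment r u s)) = 0"
    unfolding set_lebesgue_integral_def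
    by (rule integral_eq_zero_AE) (use AE_lborel_neq[of 0] in eventually_elim, auto)
  then show ?thesis
    by (simp add: free_process_def gls_integral_sub_def gls_integral_dual_kernel weyl_left_def
        set_lebesgue_integral_def)
qed

lemma free_process_increment:
  obtains C where "0 \<le> C"
    and "\<And>u A t s s'. path_bound A t u \<Longrightarrow> 0 \<le> A \<Longrightarrow> t \<le> T \<Longrightarrow> 0 \<le> s \<Longrightarrow> s \<le> s' \<Longrightarrow> s' \<le> t \<Longrightarrow>
      \<bar>Z u s' - Z u s\<bar> \<le> C * (1 + A) * (s' - s) powr (1 - \<alpha>)"
proof -
  obtain L where L: "0 \<le> L"
    and \<sigma>: "\<And>u A t. path_bound A t u \<Longrightarrow> 0 \<le> A \<Longrightarrow> t \<le> T \<Longrightarrow>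
      holder_bounded (min \<beta> \<gamma>) (L * (1 + A)) (L * (1 + A)) {0..t} (\<lambda>s. \<sigma> s (segment r u s))"
    using diffusion_holder by blast
  obtain Lb where Lb: "0 \<le> Lb"
    and bi: "\<And>u A t. path_bound A t u \<Longrightarrow> t \<le> T \<Longrightarrow>
      set_integrable lborel {0..t} (\<lambda>s. b s (segment r u s))"
    and bb: "\<And>u A t s. path_bound A t u \<Longrightarrow> t \<le> T \<Longrightarrow> s \<in> {0..t} \<Longrightarrow> \<bar>b s (segment r u s)\<bar> \<le> Lb * (1 + A)"
    using drift_bounds by blast
  obtain C where C: "0 \<le> C" and inc: "\<And>f M H s t. holder_bounded (min \<beta> \<gamma>) M H {0..t} f \<Longrightarrow> 0 \<le> H \<Longrightarrow>
      0 \<le> s \<Longrightarrow> s \<le> t \<Longrightarrow> t \<le> T \<Longrightarrow>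
      \<bar>gls_integral_sub \<alpha> 0 T 0 t f g - gls_integral_sub \<alpha> 0 T 0 s f g\<bar> \<le> C * (M + H) * (t - s) powr (1 - \<alpha>)"
    using gls_integral_sub_increment[OF W T \<alpha>(1) \<gamma>(4,6,7)] by blast
  show thesis
  proof
    \<comment> \<open>The first summand is the drift, whose linear increment is weakened to the
      exponent 1 - \<alpha> at the cost of 1 + T. The 2 arises because L (1 + A) is both sup and
      Hoelder bound of the integrand.\<close>
    show "0 \<le> Lb * (1 + T) + 2 * C * L" using L Lb C T by simp
    fix u A t s s'
    assume u: "path_bound A t u" and A: "0 \<le> A" and t: "t \<le> T" and s: "0 \<le> s" "s \<le> s'" "s' \<le> t"
    have u': "path_bound A s' u" by (rule holder_bounded_mono[OF u]) (use s in auto)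
    have s'T: "s' \<le> T" using s t by simp
    let ?b = "\<lambda>s. b s (segment r u s)"
    let ?P = "(s' - s) powr (1 - \<alpha>)"
    have i: "set_integrable lborel {0..s'} ?b" by (rule bi[OF u' s'T])
    have i1: "set_integrable lborel {0..s} ?b" by (rule set_integrable_subset[OF i]) (use s in auto)
    have i2: "set_integrable lborel {s<..s'} ?b" by (rule set_integrable_subset[OF i]) (use s in auto)
    have disj: "{0..s} \<inter> {s<..s'} = {}" by auto
    have "{0..s'} = {0..s} \<union> {s<..s'}" using s by auto
    then have "(LINT s:{0..s'}|lborel. ?b s) = (LINT s:{0..s}|lborel. ?b s) + (LINT s:{s<..s'}|lborel. ?b s)"
      using set_integral_Un[OF _ i1 i2] by (simp only: disj)
    moreover have "\<bar>LINT s:{s<..s'}|lborel. ?b s\<bar> \<le> (\<integral>x. indicator {s<..s'} x * (Lb * (1 + A)) \<partial>lborel)"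
      unfolding set_lebesgue_integral_def
    proof (rule integral_abs_bound_integral)
      show "integrable lborel (\<lambda>x. indicator {s<..s'} x *\<^sub>R ?b x)"
        using i2 by (simp add: set_integrable_def)
      show "integrable lborel (\<lambda>x. indicator {s<..s'} x * (Lb * (1 + A)))"
        by (intro integrable_mult_left integrable_indicator_interval)
    qed (use bb[OF u' s'T] s in \<open>auto simp: indicator_def\<close>)
    moreover have "(\<integral>x. indicator {s<..s'} x * (Lb * (1 + A)) \<partial>lborel) = (s' - s) * (Lb * (1 + A))"
      using s by simp
    moreover have "(s' - s) * (Lb * (1 + A)) \<le> ((1 + T) * ?P) * (Lb * (1 + A))"
      using powr_le_powr_horizon[of "s' - s" "1 - \<alpha>" 1] s t \<alpha> \<gamma> Lb A by (intro mult_right_mono) auto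
    ultimately have d: "\<bar>(LINT s:{0..s'}|lborel. ?b s) - (LINT s:{0..s}|lborel. ?b s)\<bar> \<le>
        ((1 + T) * ?P) * (Lb * (1 + A))" by linarith
    have "\<bar>gls_integral_sub \<alpha> 0 T 0 s' (\<lambda>s. \<sigma> s (segment r u s)) g
        - gls_integral_sub \<alpha> 0 T 0 s (\<lambda>s. \<sigma> s (segment r u s)) g\<bar> \<le>
        C * (L * (1 + A) + L * (1 + A)) * ?P"
      by (rule inc[OF \<sigma>[OF u' A s'T]]) (use L A s s'T in auto)
    then have "\<bar>Z u s' - Z u s\<bar> \<le> ((1 + T) * ?P) * (Lb * (1 + A)) + C * (L * (1 + A) + L * (1 + A)) * ?P"
      unfolding free_process_def using d by linarith
    also have "\<dots> = (Lb * (1 + T) + 2 * C * L) * (1 + A) * ?P" by (simp add: algebra_simps)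
    finally show "\<bar>Z u s' - Z u s\<bar> \<le> (Lb * (1 + T) + 2 * C * L) * (1 + A) * ?P" .
  qed
qed

text \<open>Causality: the segments up to time t and the cutoff to (0,t) see the path only up to t.
  The stepwise solution of the delayed equation rests on this.\<close>

lemma free_process_cong:
  assumes "\<And>s. s \<le> t \<Longrightarrow> u s = v s"
  shows "Z u t = Z v t"
proof -
  have seg: "segment r u s = segment r v s" if "s \<le> t" for s
    by (rule segment_cong[OF r]) (use assms that in auto)
  have "(LINT s:{0..t}|lborel. b s (segment r u s)) = (LINT s:{0..t}|lborel. b s (segment r v s))"
    by (rule set_lebesgue_integral_cong) (use seg in auto)
  moreover have "gls_integral_sub \<alpha> 0 T 0 t (\<lambda>s. \<sigma> s (segment r u s)) g
      = gls_integral_sub \<alpha> 0 T 0 t (\<lambda>s. \<sigma> s (segment r v s)) g"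
    by (rule gls_integral_sub_cong) (use seg in auto)
  ultimately show ?thesis by (simp add: free_process_def)
qed

lemma free_process_bdd:
  assumes u: "path_bound A t' u" and A: "0 \<le> A" and t': "t' \<le> T" and t: "t \<le> t'"
  shows "bdd_above ((\<lambda>s. max (- Z u s) 0) ` {0..t})"
proof -
  obtain C where C: "0 \<le> C" and inc: "\<And>u A t s s'. path_bound A t u \<Longrightarrow> 0 \<le> A \<Longrightarrow> t \<le> T \<Longrightarrow>
      0 \<le> s \<Longrightarrow> s \<le> s' \<Longrightarrow> s' \<le> t \<Longrightarrow>
      \<bar>Z u s' - Z u s\<bar> \<le> C * (1 + A) * (s' - s) powr (1 - \<alpha>)"
    using free_process_increment by blast
  have "continuous_on {0..t'} (Z u)"
  proof (rule holder_imp_continuous_on[where H="C * (1 + A)" and \<mu>="1 - \<alpha>"])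
    fix p q assume "p \<in> {0..t'}" "q \<in> {0..t'}"
    then show "dist (Z u p) (Z u q) \<le> C * (1 + A) * \<bar>p - q\<bar> powr (1 - \<alpha>)"
      using inc[OF u A t', of p q] inc[OF u A t', of q p]
      by (cases "p \<le> q") (auto simp: dist_real_def abs_minus_commute)
  qed (use \<gamma> in auto)
  then have "continuous_on {0..t'} (\<lambda>s. max (- Z u s) 0)" by (intro continuous_intros)
  then have "compact ((\<lambda>s. max (- Z u s) 0) ` {0..t'})" by (rule compact_continuous_image) simp
  then have "bdd_above ((\<lambda>s. max (- Z u s) 0) ` {0..t'})"
    by (intro bounded_imp_bdd_above compact_imp_bounded)
  then show ?thesis by (rule bdd_above_mono) (use t in auto)
qed

text \<open>The Lipschitz conditions turn convergence of segments into pointwise convergence of the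
  coefficients; the common path bound A supplies the domination for both integrals.\<close>

lemma free_process_tendsto:
  assumes U: "\<And>n. path_bound A T (U n)" and u: "path_bound A T u" and A: "0 \<le> A"
    and conv: "\<And>s. s \<in> {0..T} \<Longrightarrow> (\<lambda>n. norm (segment r (U n) s - segment r u s)) \<longlonglongrightarrow> 0"
    and t: "0 \<le> t" "t \<le> T"
  shows "(\<lambda>n. Z (U n) t) \<longlonglongrightarrow> Z u t"
proof -
  obtain L where L: "0 \<le> L"
    and \<sigma>: "\<And>u A t. path_bound A t u \<Longrightarrow> 0 \<le> A \<Longrightarrow> t \<le> T \<Longrightarrow>
      holder_bounded (min \<beta> \<gamma>) (L * (1 + A)) (L * (1 + A)) {0..t} (\<lambda>s. \<sigma> s (segment r u s))"
    using diffusion_holder by blast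
  obtain Lb where Lb: "0 \<le> Lb"
    and bi: "\<And>u A t. path_bound A t u \<Longrightarrow> t \<le> T \<Longrightarrow>
      set_integrable lborel {0..t} (\<lambda>s. b s (segment r u s))"
    and bb: "\<And>u A t s. path_bound A t u \<Longrightarrow> t \<le> T \<Longrightarrow> s \<in> {0..t} \<Longrightarrow> \<bar>b s (segment r u s)\<bar> \<le> Lb * (1 + A)"
    using drift_bounds by blast
  obtain K where K: "\<And>t \<phi> \<psi>. t \<in> {0..T} \<Longrightarrow> \<phi> \<in> path_space r \<Longrightarrow> \<psi> \<in> path_space r \<Longrightarrow>
        \<bar>\<sigma> t \<phi> - \<sigma> t \<psi>\<bar> \<le> K * norm (\<phi> - \<psi>)"
    using diffusion unfolding diffusion_coeff_def by metis
  obtain Kb where Kb: "\<And>t \<phi> \<psi>. t \<in> {0..T} \<Longrightarrow> \<phi> \<in> path_space r \<Longrightarrow> \<psi> \<in> path_space r \<Longrightarrow>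
        \<bar>b t \<phi> - b t \<psi>\<bar> \<le> Kb * norm (\<phi> - \<psi>)"
    using drift unfolding drift_coeff_def by metis
  have lim: "(\<lambda>n. f s (segment r (U n) s)) \<longlonglongrightarrow> f s (segment r u s)"
    if f: "\<And>t \<phi> \<psi>. t \<in> {0..T} \<Longrightarrow> \<phi> \<in> path_space r \<Longrightarrow> \<psi> \<in> path_space r \<Longrightarrow>
        \<bar>f t \<phi> - f t \<psi>\<bar> \<le> k * norm (\<phi> - \<psi>)" and s: "s \<in> {0..T}" for f :: "real \<Rightarrow> (real \<Rightarrow>\<^sub>C real) \<Rightarrow> real" and k s
  proof (rule LIM_zero_cancel, rule Lim_null_comparison)
    show "\<forall>\<^sub>F n in sequentially. norm (f s (segment r (U n) s) - f s (segment r u s))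
        \<le> k * norm (segment r (U n) s - segment r u s)"
      using f[OF s segment_bounds(1)[OF U] segment_bounds(1)[OF u]] s by auto
    show "(\<lambda>n. k * norm (segment r (U n) s - segment r u s)) \<longlonglongrightarrow> 0"
      using tendsto_mult_right_zero[OF conv[OF s]] .
  qed
  have "(\<lambda>n. gls_integral_sub \<alpha> 0 T 0 t (\<lambda>s. \<sigma> s (segment r (U n) s)) g)
      \<longlonglongrightarrow> gls_integral_sub \<alpha> 0 T 0 t (\<lambda>s. \<sigma> s (segment r u s)) g"
  proof (rule gls_integral_sub_tendsto[OF W T \<alpha>(1) \<gamma>(4,6,7) t])
    have sub: "path_bound A T v \<Longrightarrow> path_bound A t v" for v
      using t by (auto intro: holder_bounded_mono)
    show "holder_bounded (min \<beta> \<gamma>) (L * (1 + A)) (L * (1 + A)) {0..t} (\<lambda>s. \<sigma> s (segment r (U n) s))" for n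
      by (rule \<sigma>[OF sub[OF U] A t(2)])
    show "holder_bounded (min \<beta> \<gamma>) (L * (1 + A)) (L * (1 + A)) {0..t} (\<lambda>s. \<sigma> s (segment r u s))"
      by (rule \<sigma>[OF sub[OF u] A t(2)])
    show "0 \<le> L * (1 + A)" using L A by simp
    show "(\<lambda>n. \<sigma> s (segment r (U n) s)) \<longlonglongrightarrow> \<sigma> s (segment r u s)" if "s \<in> {0..t}" for s
      by (rule lim[where f=\<sigma>, OF K]) (use that t in auto)
  qed
  moreover have "(\<lambda>n. LINT s:{0..t}|lborel. b s (segment r (U n) s)) \<longlonglongrightarrow> (LINT s:{0..t}|lborel. b s (segment r u s))"
    unfolding set_lebesgue_integral_def
  proof (rule integral_dominated_convergence[where w="\<lambda>s. indicator {0..t} s * (Lb * (1 + A))"])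
    have sub: "{0..t} \<subseteq> {0..T}" using t by auto
    show "(\<lambda>s. indicator {0..t} s *\<^sub>R b s (segment r (U n) s)) \<in> borel_measurable lborel" for n
      using set_integrable_subset[OF bi[OF U order_refl] _ sub] by (simp add: set_integrable_def)
    show "(\<lambda>s. indicator {0..t} s *\<^sub>R b s (segment r u s)) \<in> borel_measurable lborel"
      using set_integrable_subset[OF bi[OF u order_refl] _ sub] by (simp add: set_integrable_def)
    show "integrable lborel (\<lambda>s. indicator {0..t} s * (Lb * (1 + A)))"
      using integrable_indicator_interval by simp
    show "AE s in lborel. (\<lambda>n. indicator {0..t} s *\<^sub>R b s (segment r (U n) s)) \<longlonglongrightarrow>
        indicator {0..t} s *\<^sub>R b s (segment r u s)"
    proof (rule AE_I2)
      fix s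
      show "(\<lambda>n. indicator {0..t} s *\<^sub>R b s (segment r (U n) s)) \<longlonglongrightarrow> indicator {0..t} s *\<^sub>R b s (segment r u s)"
      proof (cases "s \<in> {0..t}")
        case True
        then show ?thesis using lim[where f=b, OF Kb, of s] t by simp
      qed simp
    qed
    show "AE s in lborel. norm (indicator {0..t} s *\<^sub>R b s (segment r (U n) s)) \<le> indicator {0..t} s * (Lb * (1 + A))" for n
      using bb[OF U order_refl] t by (auto simp: indicator_def)
  qed
  ultimately show ?thesis unfolding free_process_def by (intro tendsto_intros)
qed

section \<open>The delayed approximations and their limit\<close>

definition initial_path :: "real \<Rightarrow> real" where
  "initial_path t = \<eta> (max (- r) (min t 0))"

text \<open>The solution map, made total: the initial path to the left of 0, the value at T frozen
  to the right of T.\<close>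

definition \<Phi> :: "(real \<Rightarrow> real) \<Rightarrow> real \<Rightarrow> real" where
  "\<Phi> u t = (if t \<le> 0 then initial_path t else Z u (min t T) + regulator (Z u) (min t T))"

text \<open>Since z(0) = \<eta>(0) is nonnegative, there is no push at time 0, and the two branches
  of \<open>\<Phi>\<close> fit together without a jump.\<close>

lemma regulator_free_process_0: "regulator (Z u) 0 = 0"
  using \<eta>_nonneg r by (simp add: regulator_def free_process_0)

lemma \<Phi>_eq:
  assumes "0 \<le> t" "t \<le> T"
  shows "\<Phi> u t = Z u t + regulator (Z u) t"
  using assms by (cases "t = 0") (auto simp: \<Phi>_def initial_path_def free_process_0 regulator_free_process_0 r less_imp_le)

lemma \<Phi>_cong:
  assumes "\<And>s. s \<le> t \<Longrightarrow> u s = v s"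
  shows "\<Phi> u t = \<Phi> v t"
proof -
  have "Z u s = Z v s" if "s \<le> t" for s
    by (rule free_process_cong) (use assms that in auto)
  then show ?thesis by (auto simp: \<Phi>_def regulator_def intro!: SUP_cong)
qed

lemma \<Phi>_increment:
  obtains C where "0 \<le> C"
    and "\<And>u A t s s'. path_bound A t u \<Longrightarrow> 0 \<le> A \<Longrightarrow> t \<le> T \<Longrightarrow> 0 \<le> s \<Longrightarrow> s \<le> s' \<Longrightarrow> s' \<le> t \<Longrightarrow>
      \<bar>\<Phi> u s' - \<Phi> u s\<bar> \<le> C * (1 + A) * (s' - s) powr (1 - \<alpha>)"
proof -
  obtain C where C: "0 \<le> C" and inc: "\<And>u A t s s'. path_bound A t u \<Longrightarrow> 0 \<le> A \<Longrightarrow> t \<le> T \<Longrightarrow>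
      0 \<le> s \<Longrightarrow> s \<le> s' \<Longrightarrow> s' \<le> t \<Longrightarrow>
      \<bar>Z u s' - Z u s\<bar> \<le> C * (1 + A) * (s' - s) powr (1 - \<alpha>)"
    using free_process_increment by blast
  show thesis
  proof
    \<comment> \<open>The regulator moves at most as much as the free process, so the constant
      doubles.\<close>
    show "0 \<le> 2 * C" using C by simp
    fix u A t s s'
    assume u: "path_bound A t u" and A: "0 \<le> A" and t: "t \<le> T" and s: "0 \<le> s" "s \<le> s'" "s' \<le> t"
    let ?e = "C * (1 + A) * (s' - s) powr (1 - \<alpha>)"
    have "\<bar>regulator (Z u) s' - regulator (Z u) s\<bar> \<le> ?e"
    proof (rule regulator_increment[OF s(1,2) free_process_bdd[OF u A t s(3)]])
      show "0 \<le> ?e" using C A by simp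
      fix w assume w: "s \<le> w" "w \<le> s'"
      have "\<bar>Z u w - Z u s\<bar> \<le> C * (1 + A) * (w - s) powr (1 - \<alpha>)" using inc[OF u A t] w s by auto
      also have "\<dots> \<le> ?e" using C A w \<gamma> by (intro mult_left_mono powr_mono2) auto
      finally show "\<bar>Z u w - Z u s\<bar> \<le> ?e" .
    qed
    moreover have "\<bar>Z u s' - Z u s\<bar> \<le> ?e" by (rule inc[OF u A t s])
    ultimately show "\<bar>\<Phi> u s' - \<Phi> u s\<bar> \<le> 2 * C * (1 + A) * (s' - s) powr (1 - \<alpha>)"
      using s t by (simp add: \<Phi>_eq)
  qed
qed

section \<open>Growth bounds preserved by the solution map\<close>

lemma initial_path_bound:
  obtains A where "1 \<le> A" "path_bound A t initial_path"
proof -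
  obtain C where C: "\<And>s t. s \<in> {-r..0} \<Longrightarrow> t \<in> {-r..0} \<Longrightarrow> \<bar>\<eta> s - \<eta> t\<bar> \<le> C * \<bar>s - t\<bar> powr \<theta>"
    using \<eta>_holder unfolding holder_on_def by blast
  define K where "K = \<bar>C\<bar> * (1 + r)"
  have K: "\<bar>\<eta> s - \<eta> t\<bar> \<le> K * \<bar>s - t\<bar> powr \<gamma>" if st: "s \<in> {-r..0}" "t \<in> {-r..0}" for s t
  proof -
    have "\<bar>s - t\<bar> powr \<theta> = \<bar>s - t\<bar> powr (\<theta> - \<gamma>) * \<bar>s - t\<bar> powr \<gamma>" by (simp flip: powr_add)
    moreover have "\<bar>s - t\<bar> powr (\<theta> - \<gamma>) \<le> (1 + r) powr (\<theta> - \<gamma>)"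
      using st by (intro powr_mono2) (auto simp: \<gamma>_def)
    moreover have "(1 + r) powr (\<theta> - \<gamma>) \<le> (1 + r) powr 1"
      using r \<theta> \<gamma> by (intro powr_mono) auto
    ultimately have "\<bar>s - t\<bar> powr \<theta> \<le> (1 + r) * \<bar>s - t\<bar> powr \<gamma>"
      using r by (simp add: mult_right_mono)
    then have "\<bar>C\<bar> * \<bar>s - t\<bar> powr \<theta> \<le> \<bar>C\<bar> * ((1 + r) * \<bar>s - t\<bar> powr \<gamma>)" by (rule mult_left_mono) simp
    moreover have "C * \<bar>s - t\<bar> powr \<theta> \<le> \<bar>C\<bar> * \<bar>s - t\<bar> powr \<theta>" by (intro mult_right_mono) auto
    ultimately show ?thesis using C[OF st] by (simp add: K_def mult.assoc)
  qed
  have K0: "0 \<le> K" using r by (simp add: K_def)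
  have bd: "\<bar>\<eta> s\<bar> \<le> \<bar>\<eta> 0\<bar> + K * r powr \<gamma>" if s: "s \<in> {-r..0}" for s
  proof -
    have "\<bar>\<eta> s - \<eta> 0\<bar> \<le> K * \<bar>s - 0\<bar> powr \<gamma>" using K[OF s, of 0] r by auto
    also have "\<dots> \<le> K * r powr \<gamma>" using s K0 \<gamma> by (intro mult_left_mono powr_mono2) auto
    finally show ?thesis by linarith
  qed
  \<comment> \<open>The summand 1 yields 1 \<le> A, which later allows 1 + 2 K to be replaced by 3
    K.\<close>
  define A where "A = 1 + \<bar>\<eta> 0\<bar> + K * r powr \<gamma> + K"
  have A: "K \<le> A" "\<bar>\<eta> 0\<bar> + K * r powr \<gamma> \<le> A" "1 \<le> A" using K0 by (auto simp: A_def)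
  have "path_bound A t initial_path"
    unfolding holder_bounded_def initial_path_def
  proof (intro conjI ballI)
    fix s t :: real
    let ?c = "\<lambda>s. max (- r) (min s 0)"
    have c: "?c s \<in> {-r..0}" "?c t \<in> {-r..0}" using r by auto
    show "\<bar>\<eta> (?c s)\<bar> \<le> A" using bd[OF c(1)] A by linarith
    have "\<bar>\<eta> (?c s) - \<eta> (?c t)\<bar> \<le> K * \<bar>?c s - ?c t\<bar> powr \<gamma>" by (rule K[OF c])
    \<comment> \<open>Clamping to [-r,0] does not increase distances, so the constant extension
      keeps the Hoelder bound on the whole line.\<close>
    also have "\<dots> \<le> A * \<bar>s - t\<bar> powr \<gamma>"
      using A K0 \<gamma> by (intro mult_mono powr_mono2) auto
    finally show "\<bar>\<eta> (?c s) - \<eta> (?c t)\<bar> \<le> A * \<bar>s - t\<bar> powr \<gamma>" .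
  qed
  then show thesis using A that by blast
qed

definition tame :: "real \<Rightarrow> real \<Rightarrow> (real \<Rightarrow> real) \<Rightarrow> bool" where
  "tame \<epsilon> A u \<longleftrightarrow> (\<forall>k::nat. path_bound (2 ^ k * A) (min (real k * \<epsilon>) T) u)"

text \<open>On each new interval the input satisfies the bound 2 K while the output is known with K
  up to its left end. The gain \<epsilon>^\<kappa>, \<kappa> = 1 - \<alpha> - \<gamma>, must bring C
  (1 + 2 K) down to K. As K \<ge> 1, it suffices that 3 C \<epsilon>^\<kappa> \<le> 1, a condition
  free of K, so the same \<epsilon> works for every interval.\<close>

lemma tame_invariant:
  obtains \<epsilon> A where "0 < \<epsilon>" "1 \<le> A" "tame \<epsilon> A initial_path" "\<And>u. tame \<epsilon> A u \<Longrightarrow> tame \<epsilon> A (\<Phi> u)"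
proof -
  obtain C where C: "0 \<le> C" and inc: "\<And>u A t s s'. path_bound A t u \<Longrightarrow> 0 \<le> A \<Longrightarrow> t \<le> T \<Longrightarrow>
      0 \<le> s \<Longrightarrow> s \<le> s' \<Longrightarrow> s' \<le> t \<Longrightarrow>
      \<bar>\<Phi> u s' - \<Phi> u s\<bar> \<le> C * (1 + A) * (s' - s) powr (1 - \<alpha>)"
    using \<Phi>_increment by blast
  obtain A where A: "1 \<le> A" "path_bound A T initial_path" using initial_path_bound by blast
  define \<kappa> where "\<kappa> = 1 - \<alpha> - \<gamma>"
  have \<kappa>: "0 < \<kappa>" using \<gamma> by (simp add: \<kappa>_def)
  \<comment> \<open>q is the target for \<epsilon>^\<kappa>; the 1 in the denominator covers C = 0.
    The cap at 1 in \<epsilon> serves the sup bound when the interval is extended.\<close>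
  define q where "q = 1 / (3 * C + 1)"
  have q: "0 < q" "3 * C * q \<le> 1" using C by (auto simp: q_def divide_simps)
  define \<epsilon> where "\<epsilon> = min 1 (q powr (1 / \<kappa>))"
  have \<epsilon>: "0 < \<epsilon>" "\<epsilon> \<le> 1" using q by (auto simp: \<epsilon>_def)
  have "\<epsilon> powr \<kappa> \<le> (q powr (1 / \<kappa>)) powr \<kappa>" using \<epsilon> \<kappa> by (intro powr_mono2) (auto simp: \<epsilon>_def)
  also have "\<dots> = q" using \<kappa> q by (simp add: powr_powr)
  finally have \<epsilon>q: "\<epsilon> powr \<kappa> \<le> q" .
  show thesis
  proof
    show "0 < \<epsilon>" "1 \<le> A" by fact+
    show "tame \<epsilon> A initial_path" unfolding tame_def
    proof
      fix k :: nat
      have "A \<le> 2 ^ k * A" using A by (simp add: mult_le_cancel_right1)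
      then show "path_bound (2 ^ k * A) (min (real k * \<epsilon>) T) initial_path"
        by (intro holder_bounded_mono[OF A(2)]) auto
    qed
    fix u assume u: "tame \<epsilon> A u"
    show "tame \<epsilon> A (\<Phi> u)" unfolding tame_def
    proof
      fix k :: nat
      show "path_bound (2 ^ k * A) (min (real k * \<epsilon>) T) (\<Phi> u)"
      proof (induction k)
        case 0
        \<comment> \<open>For k = 0 the half-line ends at 0, where the image is the initial path
          whatever u is.\<close>
        have "path_bound A 0 initial_path" by (rule holder_bounded_mono[OF A(2)]) (use T in auto)
        then show ?case using T by (simp add: holder_bounded_def \<Phi>_def)
      next
        case (Suc k)
        define K where "K = 2 ^ k * A"
        let ?t0 = "min (real k * \<epsilon>) T" and ?t1 = "min (real (Suc k) * \<epsilon>) T"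
        have a: "1 \<le> K" unfolding K_def using A by (metis mult_mono' mult_1 one_le_power one_le_numeral zero_le_one)
        have t01: "0 \<le> ?t0" "?t0 \<le> ?t1" "?t1 - ?t0 \<le> \<epsilon>" "?t1 \<le> T"
          using \<epsilon> T by (auto simp: algebra_simps min_def)
        \<comment> \<open>The input is used at index k + 1, the induction hypothesis for the output
          at index k.\<close>
        have u1: "path_bound (2 * K) ?t1 u" using u[unfolded tame_def, rule_format, of "Suc k"] by (simp add: K_def mult.assoc)
        have "path_bound (2 * K) ?t1 (\<Phi> u)"
        proof (rule holder_bounded_extend[OF Suc.IH[folded K_def] _ \<gamma>(1) t01(2)])
          show "0 \<le> K" using a by simp
          show "?t1 - ?t0 \<le> 1" using t01 \<epsilon> by simp
          fix p p' assume p: "?t0 \<le> p" "p \<le> p'" "p' \<le> ?t1"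
          have "0 \<le> p" using p(1) t01(1) by linarith
          then have "\<bar>\<Phi> u p' - \<Phi> u p\<bar> \<le> C * (1 + 2 * K) * (p' - p) powr (1 - \<alpha>)"
            by (intro inc[OF u1 _ t01(4)]) (use a p in auto)
          also have "(p' - p) powr (1 - \<alpha>) = (p' - p) powr \<kappa> * (p' - p) powr \<gamma>"
            by (simp add: \<kappa>_def flip: powr_add)
          also have "C * (1 + 2 * K) * ((p' - p) powr \<kappa> * (p' - p) powr \<gamma>) \<le>
              C * (3 * K) * (q * (p' - p) powr \<gamma>)"
          proof (intro mult_mono)
            have "(p' - p) powr \<kappa> \<le> \<epsilon> powr \<kappa>" using p t01(3) \<kappa> by (intro powr_mono2) auto
            then show "(p' - p) powr \<kappa> \<le> q" using \<epsilon>q by linarith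
          qed (use C a q in auto)
          also have "\<dots> = (3 * C * q) * (K * (p' - p) powr \<gamma>)" by simp
          also have "\<dots> \<le> 1 * (K * (p' - p) powr \<gamma>)" using q a by (intro mult_right_mono) auto
          finally show "\<bar>\<Phi> u p' - \<Phi> u p\<bar> \<le> K * (p' - p) powr \<gamma>" by simp
        qed
        then show ?case by (simp add: K_def mult.assoc)
      qed
    qed
  qed
qed

section \<open>The delayed equation and passage to the limit\<close>

lemma path_bound_shift:
  assumes "path_bound A t u" "0 \<le> d"
  shows "path_bound A t (\<lambda>s. u (s - d))"
  unfolding holder_bounded_def
proof (intro conjI ballI)
  fix s s' assume "s \<in> {..t}" "s' \<in> {..t}"
  then show "\<bar>u (s - d)\<bar> \<le> A" "\<bar>u (s - d) - u (s' - d)\<bar> \<le> A * \<bar>s - s'\<bar> powr \<gamma>"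
    using holder_boundedD(1)[OF assms(1), of "s - d"] holder_boundedD(2)[OF assms(1), of "s - d" "s' - d"] assms(2)
    by auto
qed

text \<open>By causality the delayed map determines its output up to t + d from its input up to t.
  Starting from the initial path, the n-th iterate is therefore final on times up to n d, and
  finitely many iterations give an exact fixed point up to T; every iterate stays tame.\<close>

lemma delayed_solution:
  assumes inv: "tame \<epsilon> A initial_path" "\<And>u. tame \<epsilon> A u \<Longrightarrow> tame \<epsilon> A (\<Phi> u)" and d: "0 < d"
  shows "\<exists>X. tame \<epsilon> A X \<and> (\<forall>t\<le>T. X t = \<Phi> (\<lambda>s. X (s - d)) t)"
proof -
  define X where "X n = ((\<lambda>u. \<Phi> (\<lambda>s. u (s - d))) ^^ n) initial_path" for n
  have XS: "X (Suc n) = \<Phi> (\<lambda>s. X n (s - d))" for n by (simp add: X_def)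
  have tame: "tame \<epsilon> A (X n)" for n
  proof (induction n)
    case 0
    then show ?case using inv by (simp add: X_def)
  next
    case (Suc n)
    then have "tame \<epsilon> A (\<lambda>s. X n (s - d))" using path_bound_shift d by (auto simp: tame_def)
    then show ?case unfolding XS by (rule inv)
  qed
  have stable: "t \<le> real n * d \<Longrightarrow> X (Suc n) t = X n t" for t and n :: nat
  proof (induction n arbitrary: t)
    case 0
    then show ?case by (simp add: X_def \<Phi>_def)
  next
    case (Suc n)
    have "X (Suc n) (s - d) = X n (s - d)" if "s \<le> t" for s
      by (rule Suc.IH) (use Suc.prems that in \<open>auto simp: algebra_simps\<close>)
    then show ?case unfolding XS[of "Suc n"] XS[of n] by (intro \<Phi>_cong) (auto simp: XS)
  qed
  obtain n :: nat where "T < real n * d" using reals_Archimedean3[OF d] by blast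
  then have "X n t = \<Phi> (\<lambda>s. X n (s - d)) t" if "t \<le> T" for t
    using stable[of t n] that by (simp add: XS)
  then show ?thesis using tame by blast
qed

lemma reflected_solution_exists:
  "\<exists>x. reflected_solution \<alpha> T r \<eta> b \<sigma> g x \<and> holder_on \<gamma> {-r..T} x"
proof -
  obtain \<epsilon> A0 where \<epsilon>: "0 < \<epsilon>" and A0: "1 \<le> A0" and inv: "tame \<epsilon> A0 initial_path"
    "\<And>u. tame \<epsilon> A0 u \<Longrightarrow> tame \<epsilon> A0 (\<Phi> u)"
    using tame_invariant by blast
  obtain N :: nat where N: "T < real N * \<epsilon>" using reals_Archimedean3[OF \<epsilon>] by blast
  define A where "A = 2 ^ N * A0"
  have A: "0 \<le> A" using A0 by (simp add: A_def)
  \<comment> \<open>After N steps the horizon T is covered, so one constant bounds tame paths up to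
    T, independently of the delay.\<close>
  have tb: "path_bound A T u" if "tame \<epsilon> A0 u" for u
    using that[unfolded tame_def, rule_format, of N] N by (simp add: A_def min_def split: if_splits)
  define d where "d n = 1 / real (Suc n)" for n
  have d: "0 < d n" for n by (simp add: d_def)
  have dlim: "d \<longlonglongrightarrow> 0" unfolding d_def by (rule lim_1_over_n[THEN LIMSEQ_Suc])
  obtain X where Xt: "\<And>n. tame \<epsilon> A0 (X n)" and Xfix: "\<And>n t. t \<le> T \<Longrightarrow> X n t = \<Phi> (\<lambda>s. X n (s - d n)) t"
    using delayed_solution[OF inv d] by metis
  define U where "U n s = X n (s - d n)" for n s
  have X: "path_bound A T (X n)" for n by (rule tb[OF Xt])
  have U: "path_bound A T (U n)" for n
    unfolding U_def[abs_def] by (rule path_bound_shift[OF X]) (use d[of n] in simp)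
  have XU: "X n t = \<Phi> (U n) t" if "t \<le> T" for n t
    using Xfix[OF that] by (simp add: U_def[abs_def])
  obtain C where C: "0 \<le> C" and inc: "\<And>u A t s s'. path_bound A t u \<Longrightarrow> 0 \<le> A \<Longrightarrow> t \<le> T \<Longrightarrow>
      0 \<le> s \<Longrightarrow> s \<le> s' \<Longrightarrow> s' \<le> t \<Longrightarrow>
      \<bar>Z u s' - Z u s\<bar> \<le> C * (1 + A) * (s' - s) powr (1 - \<alpha>)"
    using free_process_increment by blast
  define D where "D = C * (1 + A)"
  have D: "0 \<le> D" using C A by (simp add: D_def)
  have Zinc: "\<bar>Z (U n) p - Z (U n) q\<bar> \<le> D * \<bar>p - q\<bar> powr (1 - \<alpha>)" if "p \<in> {0..T}" "q \<in> {0..T}" for n p q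
    using inc[OF U A order_refl, of p q] inc[OF U A order_refl, of q p] that
    by (cases "p \<le> q") (auto simp: D_def abs_minus_commute)
  \<comment> \<open>The path and its free process are treated as one map into the plane, so a single
    subsequence makes both converge uniformly. Uniform convergence of the free process is what the
    regulator requires.\<close>
  let ?F = "\<lambda>n t. (X n t, Z (U n) t)"
  have pair: "norm (p, q) \<le> \<bar>p\<bar> + \<bar>q\<bar>" for p q :: real
    using sqrt_sum_squares_le_sum_abs[of p q] by (simp add: norm_Pair)
  obtain G k where G: "strict_mono (k :: nat \<Rightarrow> nat)"
    "\<And>e. 0 < e \<Longrightarrow> \<exists>N. \<forall>n x. n \<ge> N \<and> x \<in> {0..T} \<longrightarrow> norm (?F (k n) x - G x) < e"
  proof (rule Arzela_Ascoli[of "{0..T}" ?F "A + (\<bar>\<eta> 0\<bar> + D * T powr (1 - \<alpha>))"])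
    show "compact {0..T}" by simp
    show "norm (X n t, Z (U n) t) \<le> A + (\<bar>\<eta> 0\<bar> + D * T powr (1 - \<alpha>))" if t: "t \<in> {0..T}" for n t
    proof -
      have "\<bar>X n t\<bar> \<le> A" using holder_boundedD(1)[OF X] t by auto
      moreover have "\<bar>Z (U n) t - \<eta> 0\<bar> \<le> D * t powr (1 - \<alpha>)"
        using Zinc[of t 0 n] t T by (auto simp: free_process_0)
      moreover have "D * t powr (1 - \<alpha>) \<le> D * T powr (1 - \<alpha>)"
        using t D \<gamma> by (intro mult_left_mono powr_mono2) auto
      ultimately show ?thesis using pair[of "X n t" "Z (U n) t"] by linarith
    qed
    show "\<exists>\<delta>>0. \<forall>n y. y \<in> {0..T} \<and> norm (t - y) < \<delta> \<longrightarrow> norm (?F n t - ?F n y) < e"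
      if t: "t \<in> {0..T}" and e: "0 < e" for t e
    proof -
      have "((\<lambda>v. A * \<bar>v\<bar> powr \<gamma> + D * \<bar>v\<bar> powr (1 - \<alpha>)) \<longlongrightarrow> A * \<bar>0\<bar> powr \<gamma> + D * \<bar>0\<bar> powr (1 - \<alpha>)) (at 0)"
        using \<gamma> by (intro tendsto_intros) (auto simp: eventually_at_filter)
      then have "((\<lambda>v. A * \<bar>v\<bar> powr \<gamma> + D * \<bar>v\<bar> powr (1 - \<alpha>)) \<longlongrightarrow> 0) (at 0)" by simp
      from order_tendstoD(2)[OF this e] obtain \<delta> where \<delta>: "\<delta> > 0"
        "\<And>v. v \<noteq> 0 \<Longrightarrow> \<bar>v\<bar> < \<delta> \<Longrightarrow> A * \<bar>v\<bar> powr \<gamma> + D * \<bar>v\<bar> powr (1 - \<alpha>) < e"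
        unfolding eventually_at by (auto simp: dist_real_def)
      show ?thesis
      proof (intro exI[of _ \<delta>] conjI allI impI \<delta>(1))
        fix n y assume y: "y \<in> {0..T} \<and> norm (t - y) < \<delta>"
        show "norm (?F n t - ?F n y) < e"
        proof (cases "t = y")
          case True
          then show ?thesis using e by simp
        next
          case False
          have "norm (?F n t - ?F n y) \<le> \<bar>X n t - X n y\<bar> + \<bar>Z (U n) t - Z (U n) y\<bar>"
            using pair[of "X n t - X n y" "Z (U n) t - Z (U n) y"] by simp
          also have "\<dots> \<le> A * \<bar>t - y\<bar> powr \<gamma> + D * \<bar>t - y\<bar> powr (1 - \<alpha>)"
            using t y by (intro add_mono holder_boundedD(2)[OF X] Zinc) auto
          also have "\<dots> < e" using \<delta>(2)[of "t - y"] y False by simp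
          finally show ?thesis .
        qed
      qed
    qed
  qed blast
  \<comment> \<open>Arzela-Ascoli gives the limit on [0,T] only; to the left all approximations
    coincide with the initial path, so the limit inherits the bound on the half-line.\<close>
  define x where "x t = (if t \<le> 0 then initial_path t else fst (G t))" for t
  have Xinit: "X n t = initial_path t" if "t \<le> 0" for n t
    using XU[of t n] that T by (simp add: \<Phi>_def)
  have fst_le: "\<bar>p - fst a\<bar> \<le> norm ((p, q) - a)" and snd_le: "\<bar>q - snd a\<bar> \<le> norm ((p, q) - a)"
    for p q :: real and a
    using norm_fst_le[of "p - fst a" "q - snd a"] norm_snd_le[of "q - snd a" "p - fst a"]
    by (simp_all add: minus_prod_def)
  have Xunif: "\<exists>N. \<forall>n\<ge>N. \<forall>t\<le>T. \<bar>X (k n) t - x t\<bar> < e" if e: "0 < e" for e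
  proof -
    obtain N where N: "\<And>n t. n \<ge> N \<Longrightarrow> t \<in> {0..T} \<Longrightarrow> norm (?F (k n) t - G t) < e" using G(2)[OF e] by blast
    have "\<bar>X (k n) t - x t\<bar> < e" if "n \<ge> N" "t \<le> T" for n t
    proof (cases "t \<le> 0")
      case True
      then show ?thesis using Xinit e by (simp add: x_def)
    next
      case False
      then show ?thesis using N[of n t] that fst_le[of "X (k n) t" "G t" "Z (U (k n)) t"] by (simp add: x_def)
    qed
    then show ?thesis by blast
  qed
  have Xconv: "(\<lambda>n. X (k n) t) \<longlonglongrightarrow> x t" if "t \<le> T" for t
    unfolding LIMSEQ_iff real_norm_def using Xunif that by blast
  have x: "path_bound A T x" by (rule holder_bounded_limit[where F="\<lambda>n. X (k n)", OF X]) (use Xconv in auto)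
  have dk: "(\<lambda>n. A * d (k n) powr \<gamma>) \<longlonglongrightarrow> 0"
  proof -
    have "(\<lambda>n. d (k n)) \<longlonglongrightarrow> 0" using LIMSEQ_subseq_LIMSEQ[OF dlim G(1)] by (simp add: o_def)
    then have "(\<lambda>n. A * d (k n) powr \<gamma>) \<longlonglongrightarrow> A * 0 powr \<gamma>"
      using \<gamma> d[THEN less_imp_le] by (intro tendsto_intros) auto
    then show ?thesis by simp
  qed
  \<comment> \<open>The delayed path differs from the undelayed one by at most A d^\<gamma>,
    uniformly in time, and the latter converges uniformly.\<close>
  have Uconv: "(\<lambda>n. norm (segment r (U (k n)) s - segment r x s)) \<longlonglongrightarrow> 0" if s: "s \<in> {0..T}" for s
    unfolding LIMSEQ_iff
  proof (intro allI impI)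
    fix e :: real assume e: "0 < e"
    have "0 < e / 3" using e by simp
    then obtain N1 where N1: "\<And>n t. n \<ge> N1 \<Longrightarrow> t \<le> T \<Longrightarrow> \<bar>X (k n) t - x t\<bar> < e / 3"
      using Xunif by meson
    have "\<forall>\<^sub>F n in sequentially. A * d (k n) powr \<gamma> < e / 3" by (rule order_tendstoD(2)[OF dk]) (use e in simp)
    then obtain N2 where N2: "\<And>n. n \<ge> N2 \<Longrightarrow> A * d (k n) powr \<gamma> < e / 3"
      by (auto simp: eventually_sequentially)
    show "\<exists>N. \<forall>n\<ge>N. norm (norm (segment r (U (k n)) s - segment r x s) - 0) < e"
    proof (intro exI[of _ "max N1 N2"] allI impI)
      fix n assume n: "max N1 N2 \<le> n"
      have "norm (segment r (U (k n)) s - segment r x s) \<le> 2 * e / 3"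
      proof (rule segment_diff_norm_le[OF r])
        show "continuous_on {s-r..s} (U (k n))" "continuous_on {s-r..s} x"
          using path_bound_continuous[OF U] path_bound_continuous[OF x] s by auto
        fix w assume w: "w \<in> {-r..0}"
        have "\<bar>X (k n) (s + w - d (k n)) - X (k n) (s + w)\<bar> \<le> A * \<bar>(s + w - d (k n)) - (s + w)\<bar> powr \<gamma>"
          by (rule holder_boundedD(2)[OF X]) (use w s d[of "k n"] in auto)
        then have "\<bar>U (k n) (s + w) - X (k n) (s + w)\<bar> < e / 3"
          using N2[of n] n d[of "k n"] by (simp add: U_def)
        moreover have "\<bar>X (k n) (s + w) - x (s + w)\<bar> < e / 3" using N1[of n "s + w"] n w s by auto
        ultimately show "\<bar>U (k n) (s + w) - x (s + w)\<bar> \<le> 2 * e / 3" by linarith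
      qed
      then show "norm (norm (segment r (U (k n)) s - segment r x s) - 0) < e" using e by simp
    qed
  qed
  have Zconv: "(\<lambda>n. Z (U (k n)) t) \<longlonglongrightarrow> Z x t" if "t \<in> {0..T}" for t
    by (rule free_process_tendsto[where U="\<lambda>n. U (k n)", OF U x A Uconv]) (use that in auto)
  \<comment> \<open>The second component converges uniformly to an unidentified limit; continuity of
    the free process in the path identifies it pointwise.\<close>
  have Gz: "snd (G t) = Z x t" if t: "t \<in> {0..T}" for t
  proof (rule LIMSEQ_unique[OF _ Zconv[OF t]])
    show "(\<lambda>n. Z (U (k n)) t) \<longlonglongrightarrow> snd (G t)" unfolding LIMSEQ_iff
    proof (intro allI impI)
      fix e :: real assume "0 < e"
      then obtain N where "\<And>n. n \<ge> N \<Longrightarrow> norm (?F (k n) t - G t) < e" using G(2) t by blast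
      then show "\<exists>N. \<forall>n\<ge>N. norm (Z (U (k n)) t - snd (G t)) < e"
        using snd_le by (metis order_le_less_trans real_norm_def)
    qed
  qed
  have main: "x t = Z x t + regulator (Z x) t" if t: "t \<in> {0..T}" for t
  proof (rule LIMSEQ_unique[OF Xconv])
    show "t \<le> T" using t by simp
    \<comment> \<open>The regulator at t depends on the free process over all of [0,t], so the
      uniform bound from Arzela-Ascoli is used, not just the pointwise limit.\<close>
    have "(\<lambda>n. regulator (Z (U (k n))) t) \<longlonglongrightarrow> regulator (Z x) t" unfolding LIMSEQ_iff
    proof (intro allI impI)
      fix e :: real assume e: "0 < e"
      then obtain N where N: "\<And>n s. n \<ge> N \<Longrightarrow> s \<in> {0..T} \<Longrightarrow> norm (?F (k n) s - G s) < e / 2"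
        using G(2)[of "e / 2"] by auto
      show "\<exists>N. \<forall>n\<ge>N. norm (regulator (Z (U (k n))) t - regulator (Z x) t) < e"
      proof (intro exI[of _ N] allI impI)
        fix n assume n: "N \<le> n"
        have "\<bar>regulator (Z (U (k n))) t - regulator (Z x) t\<bar> \<le> e / 2"
        proof (rule regulator_perturb)
          fix s assume "s \<in> {0..t}"
          then have s: "s \<in> {0..T}" using t by auto
          show "\<bar>Z (U (k n)) s - Z x s\<bar> \<le> e / 2"
            using N[OF n s] snd_le[of "Z (U (k n)) s" "G s" "X (k n) s"] Gz[OF s] by simp
        qed (use t free_process_bdd[OF U A order_refl] free_process_bdd[OF x A order_refl] in auto)
        then show "norm (regulator (Z (U (k n))) t - regulator (Z x) t) < e" using e by simp
      qed
    qed
    then have "(\<lambda>n. Z (U (k n)) t + regulator (Z (U (k n))) t) \<longlonglongrightarrow> Z x t + regulator (Z x) t"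
      by (intro tendsto_add Zconv t)
    then show "(\<lambda>n. X (k n) t) \<longlonglongrightarrow> Z x t + regulator (Z x) t"
      using XU \<Phi>_eq t by simp
  qed
  obtain L where L: "0 \<le> L"
    and \<sigma>: "\<And>u A t. path_bound A t u \<Longrightarrow> 0 \<le> A \<Longrightarrow> t \<le> T \<Longrightarrow>
      holder_bounded (min \<beta> \<gamma>) (L * (1 + A)) (L * (1 + A)) {0..t} (\<lambda>s. \<sigma> s (segment r u s))"
    using diffusion_holder by blast
  have xt: "path_bound A t x" if "t \<le> T" for t
    by (rule holder_bounded_mono[OF x]) (use that in auto)
  have "reflected_solution \<alpha> T r \<eta> b \<sigma> g x"
    unfolding reflected_solution_def
  proof (intro conjI ballI)
    show "continuous_on {-r..T} x" by (rule path_bound_continuous[OF x]) auto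
    show "set_integrable lborel {0..t} (\<lambda>s. b s (segment r x s))" if "t \<in> {0..T}" for t
      using drift_bounds xt[of t] that by (metis atLeastAtMost_iff)
    show "gls_integrable_sub \<alpha> 0 T 0 t (\<lambda>s. \<sigma> s (segment r x s)) g" if "t \<in> {0<..T}" for t
      by (rule gls_integrable_sub_holder[OF W T _ _ \<alpha>(1) \<gamma>(4,6,7) \<sigma>[OF xt A]]) (use that L A in auto)
    show "bdd_above ((\<lambda>s. max (- Z x s) 0) ` {0..T})" by (rule free_process_bdd[OF x A order_refl order_refl])
    show "x t = Z x t + regulator (Z x) t" if "t \<in> {0..T}" for t by (rule main[OF that])
    show "x t = \<eta> t" if "t \<in> {-r..0}" for t using that by (simp add: x_def initial_path_def)
  qed
  moreover have "holder_on \<gamma> {-r..T} x"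
    unfolding holder_on_def using holder_boundedD(2)[OF x] by (intro exI[of _ A]) auto
  ultimately show ?thesis by blast
qed

end

theorem theorem4p1:
  fixes T r \<theta> \<alpha> \<beta> :: real
    and \<eta> g :: "real \<Rightarrow> real"
    and b \<sigma> :: "real \<Rightarrow> (real \<Rightarrow>\<^sub>C real) \<Rightarrow> real"
  assumes "T > 0" and "r > 0"
    and "0 < \<theta>" and "\<theta> \<le> 1"
    and "\<forall>s\<in>{-r..0}. \<eta> s \<ge> 0" and "holder_on \<theta> {-r..0} \<eta>"
    and "drift_coeff T r b"
    and "0 < \<beta>" and "\<beta> < 1" and "diffusion_coeff T r \<beta> \<sigma>"
    and "0 < \<alpha>" and "\<alpha> < min (1/2) (min \<theta> \<beta>)"
    and "W_space \<alpha> T g"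
  shows "\<exists>x. reflected_solution \<alpha> T r \<eta> b \<sigma> g x \<and> holder_on (min \<theta> (1/2)) {-r..T} x"
proof -
  interpret reflected_delay_equation T r \<theta> \<alpha> \<beta> \<eta> g b \<sigma>
    by unfold_locales (use assms in auto)
  show ?thesis using reflected_solution_exists by (simp add: \<gamma>_def)
qed

end
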